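(* There is an algorithm which takes a graph $G$ as input, runs in XP time with respect to the treewidth of $G$ (i.e., in time $f(\mathrm{tw})\cdot n^{g(\mathrm{tw})}$ for computable $f,g$, where $n=|V(G)|$ and $\mathrm{tw}$ is the treewidth of $G$), and correctly decides whether $G$ admits a proper weight function $w:E(G)\to\{0,1\}$; if such a function exists, the algorithm outputs one.
   Context: All graphs are finite, simple, undirected, and have no isolated edges. For $w:E(G)\to\{0,1\}$, the color of a vertex $v$ is $\mathrm{color}_w(v)=\sum_{e\ni v} w(e)$. The function $w$ is a proper weight function if $\mathrm{color}_w(u)\neq\mathrm{color}_w(v)$ for every edge $uv\in E(G)$. *)

theory Defs
  imports Main
begin

section \<open>Graphs, treewidth and proper weight functions\<close>

definition simple_graph :: "'a set \<Rightarrow> 'a set set \<Rightarrow> bool" where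
  "simple_graph V E \<longleftrightarrow> finite V \<and> (\<forall>e\<in>E. e \<subseteq> V \<and> card e = 2)"

definition no_isolated_edges :: "'a set set \<Rightarrow> bool" where
  "no_isolated_edges E \<longleftrightarrow> (\<forall>e\<in>E. \<exists>e'\<in>E. e' \<noteq> e \<and> e \<inter> e' \<noteq> {})"

definition color :: "'a set set \<Rightarrow> ('a set \<Rightarrow> nat) \<Rightarrow> 'a \<Rightarrow> nat" where
  "color E w v = (\<Sum>e | e \<in> E \<and> v \<in> e. w e)"

definition proper_weight :: "'a set set \<Rightarrow> ('a set \<Rightarrow> nat) \<Rightarrow> bool" where
  "proper_weight E w \<longleftrightarrow>
     (\<forall>e\<in>E. w e \<in> {0, 1}) \<and> (\<forall>u v. {u, v} \<in> E \<longrightarrow> color E w u \<noteq> color E w v)"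

definition connected_graph :: "'a set \<Rightarrow> 'a set set \<Rightarrow> bool" where
  "connected_graph V E \<longleftrightarrow> V \<noteq> {} \<and> (\<forall>u\<in>V. \<forall>v\<in>V. (u, v) \<in> {(x, y). {x, y} \<in> E}\<^sup>*)"

definition is_cycle :: "'a set set \<Rightarrow> 'a list \<Rightarrow> bool" where
  "is_cycle E c \<longleftrightarrow> length c \<ge> 3 \<and> distinct c \<and>
     (\<forall>i < length c. {c ! i, c ! (Suc i mod length c)} \<in> E)"

definition is_tree :: "'a set \<Rightarrow> 'a set set \<Rightarrow> bool" where
  "is_tree V E \<longleftrightarrow> simple_graph V E \<and> connected_graph V E \<and> (\<nexists>c. is_cycle E c)"

definition tree_decomposition ::
  "'a set \<Rightarrow> 'a set set \<Rightarrow> 'b set \<Rightarrow> 'b set set \<Rightarrow> ('b \<Rightarrow> 'a set) \<Rightarrow> bool" where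
  "tree_decomposition V E I F B \<longleftrightarrow>
     is_tree I F \<and>
     (\<Union>t\<in>I. B t) = V \<and>
     (\<forall>e\<in>E. \<exists>t\<in>I. e \<subseteq> B t) \<and>
     (\<forall>v\<in>V. let S = {t \<in> I. v \<in> B t} in connected_graph S {e \<in> F. e \<subseteq> S})"

definition width :: "'b set \<Rightarrow> ('b \<Rightarrow> 'a set) \<Rightarrow> nat" where
  "width I B = Max ((\<lambda>t. card (B t)) ` I) - 1"

text \<open>
  Since decomposition trees are finite, it is no restriction to take their nodes from
  \<^typ>\<open>nat\<close>.  With truncated subtraction in \<^const>\<open>width\<close> the graph without vertices has
  treewidth 0.
\<close>

definition treewidth :: "'a set \<Rightarrow> 'a set set \<Rightarrow> nat" where
  "treewidth V E = (LEAST k. \<exists>(I :: nat set) F B. tree_decomposition V E I F B \<and> width I B = k)"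

section \<open>Model of computation\<close>

text \<open>
  Programs compute on binary trees with a single atom, as in Jones's WHILE language and its
  one-variable fragment (N. D. Jones, Computability and Complexity from a Programming
  Perspective).  A program transforms one value into another, and its running time counts the
  executed instructions.  A step is a bounded number of pointer operations on shared tree
  cells; the only test is a comparison with \<open>Null\<close>.  Hence running times agree
  with those of Turing machines up to a polynomial, and the class XP is the same in both models.
\<close>

datatype val = Null | Pair val val

datatype prog =
    Self
  | Const_Null
  | First
  | Second
  | Make_Pair prog prog
  | Seq prog prog
  | Cond prog prog prog
  | While prog prog

text \<open>
  \<open>exec p x y t\<close>: on input \<open>x\<close> the program \<open>p\<close> halts with result \<open>y\<close> after \<open>t\<close> steps.
\<close>

inductive exec :: "prog \<Rightarrow> val \<Rightarrow> val \<Rightarrow> nat \<Rightarrow> bool" where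
  Self: "exec Self x x 1"
| Const_Null: "exec Const_Null x Null 1"
| First_Null: "exec First Null Null 1"
| First_Pair: "exec First (Pair a b) a 1"
| Second_Null: "exec Second Null Null 1"
| Second_Pair: "exec Second (Pair a b) b 1"
| Make_Pair: "exec p x a s \<Longrightarrow> exec q x b t \<Longrightarrow> exec (Make_Pair p q) x (Pair a b) (s + t + 1)"
| Seq: "exec p x y s \<Longrightarrow> exec q y z t \<Longrightarrow> exec (Seq p q) x z (s + t + 1)"
| Cond_True: "exec c x b s \<Longrightarrow> b \<noteq> Null \<Longrightarrow> exec p x y t \<Longrightarrow> exec (Cond c p q) x y (s + t + 1)"
| Cond_False: "exec c x Null s \<Longrightarrow> exec q x y t \<Longrightarrow> exec (Cond c p q) x y (s + t + 1)"
| While_False: "exec c x Null s \<Longrightarrow> exec (While c p) x x (s + 1)"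
| While_True: "exec c x b s \<Longrightarrow> b \<noteq> Null \<Longrightarrow> exec p x y t \<Longrightarrow> exec (While c p) y z u \<Longrightarrow>
    exec (While c p) x z (s + t + u + 1)"

inductive_cases exec_SelfE: "exec Self x y t"
inductive_cases exec_Const_NullE: "exec Const_Null x y t"
inductive_cases exec_First_NullE: "exec First Null y t"
inductive_cases exec_First_PairE: "exec First (Pair a b) y t"
inductive_cases exec_Second_NullE: "exec Second Null y t"
inductive_cases exec_Second_PairE: "exec Second (Pair a b) y t"
inductive_cases exec_Make_PairE: "exec (Make_Pair p q) x y t"
inductive_cases exec_SeqE: "exec (Seq p q) x y t"
inductive_cases exec_CondE: "exec (Cond c p q) x y t"
inductive_cases exec_WhileE: "exec (While c p) x y t"

lemma exec_deterministic:
  "exec p x y t \<Longrightarrow> exec p x y' t' \<Longrightarrow> y' = y \<and> t' = t"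
proof (induction arbitrary: y' t' rule: exec.induct)
  case (Self x)
  then show ?case by (auto elim: exec_SelfE)
next
  case (Const_Null x)
  then show ?case by (auto elim: exec_Const_NullE)
next
  case First_Null
  then show ?case by (auto elim: exec_First_NullE)
next
  case (First_Pair a b)
  then show ?case by (auto elim: exec_First_PairE)
next
  case Second_Null
  then show ?case by (auto elim: exec_Second_NullE)
next
  case (Second_Pair a b)
  then show ?case by (auto elim: exec_Second_PairE)
next
  case (Make_Pair p x a s q b t)
  from Make_Pair.prems Make_Pair.hyps show ?case
    by (auto elim!: exec_Make_PairE dest!: Make_Pair.IH)
next
  case (Seq p x y s q z t)
  from Seq.prems Seq.hyps show ?case
    by (auto elim!: exec_SeqE dest!: Seq.IH)
next
  case (Cond_True c x b s p y t q)
  from Cond_True.prems Cond_True.hyps show ?case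
    by (auto elim!: exec_CondE dest!: Cond_True.IH)
next
  case (Cond_False c x s q y t p)
  from Cond_False.prems Cond_False.hyps show ?case
    by (auto elim!: exec_CondE dest!: Cond_False.IH)
next
  case (While_False c x s p)
  from While_False.prems While_False.hyps show ?case
    by (auto elim!: exec_WhileE dest!: While_False.IH)
next
  case (While_True c x b s p y t z u)
  from While_True.prems While_True.hyps show ?case
    by (auto elim!: exec_WhileE dest!: While_True.IH)
qed

fun encode_list :: "val list \<Rightarrow> val" where
  "encode_list [] = Null"
| "encode_list (x # xs) = Pair x (encode_list xs)"

fun encode_bool :: "bool \<Rightarrow> val" where
  "encode_bool False = Null"
| "encode_bool True = Pair Null Null"

definition encode_nat :: "nat \<Rightarrow> val" where
  "encode_nat n = encode_list (replicate n Null)"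

definition computable :: "(nat \<Rightarrow> nat) \<Rightarrow> bool" where
  "computable f \<longleftrightarrow> (\<exists>p. \<forall>k. \<exists>t. exec p (encode_nat k) (encode_nat (f k)) t)"

definition encode_matrix :: "nat \<Rightarrow> (nat \<Rightarrow> nat \<Rightarrow> bool) \<Rightarrow> val" where
  "encode_matrix n A =
     encode_list (map (\<lambda>i. encode_list (map (\<lambda>j. encode_bool (A i j)) [0..<n])) [0..<n])"

text \<open>
  Input graphs have vertex set \<open>{..<n}\<close> and are given by their adjacency matrix.  A weight
  function is returned as the matrix of the edges of weight 1; the extra pair around it
  separates a positive answer from the negative answer \<^const>\<open>Null\<close>, also when the matrix is empty.
\<close>

definition encode_graph :: "nat \<Rightarrow> nat set set \<Rightarrow> val" where
  "encode_graph n E = encode_matrix n (\<lambda>i j. {i, j} \<in> E)"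

definition encode_weights :: "nat \<Rightarrow> nat set set \<Rightarrow> (nat set \<Rightarrow> nat) \<Rightarrow> val" where
  "encode_weights n E w = Pair Null (encode_matrix n (\<lambda>i j. {i, j} \<in> E \<and> w {i, j} = 1))"

definition correct_answer :: "nat \<Rightarrow> nat set set \<Rightarrow> val \<Rightarrow> bool" where
  "correct_answer n E y \<longleftrightarrow>
     (if \<exists>w. proper_weight E w then \<exists>w. proper_weight E w \<and> y = encode_weights n E w
      else y = Null)"

text \<open>
  The base \<open>max 1 n\<close> differs from \<open>n\<close> only for the graph without vertices, where \<open>n ^ d\<close> would
  be 0 for positive \<open>d\<close> although every program takes at least one step.
\<close>

definition runs_in_XP_time :: "prog \<Rightarrow> bool" where
  "runs_in_XP_time p \<longleftrightarrow>
     (\<exists>f g. computable f \<and> computable g \<and>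
        (\<forall>n E. simple_graph {..<n} E \<and> no_isolated_edges E \<longrightarrow>
           (\<exists>y t. exec p (encode_graph n E) y t \<and>
              t \<le> f (treewidth {..<n} E) * max 1 n ^ g (treewidth {..<n} E))))"

definition decides_proper_weight :: "prog \<Rightarrow> bool" where
  "decides_proper_weight p \<longleftrightarrow>
     (\<forall>n E. simple_graph {..<n} E \<and> no_isolated_edges E \<longrightarrow>
        (\<exists>y t. exec p (encode_graph n E) y t \<and> correct_answer n E y))"

end

theory Submission imports Defs
begin

text \<open>
  No tree decomposition is ever computed.  For \<open>K = 1, 2, \<dots>\<close> the algorithm runs a local consistency
  test: for every vertex tuple \<open>X\<close> of length \<open>K\<close> and every class \<open>D\<close> of edges that are connected
  outside \<open>X\<close> it keeps the colorings \<open>c\<close> of \<open>X\<close> and the contributions \<open>s\<close> of \<open>D\<close> to these colors for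
  which every tuple \<open>Y\<close> that contains the common vertices of \<open>X\<close> and \<open>D\<close> has a coloring compatible with
  \<open>c\<close> such that \<open>s\<close> is a sum of surviving contributions of the \<open>Y\<close>-classes of \<open>D\<close>.  A real solution
  survives all tests, hence a failure proves that there is none, whatever \<open>K\<close> is.  If \<open>K\<close> exceeds the
  treewidth, then the tuples \<open>Y\<close> include the bags of a decomposition, and walking down its tree turns
  surviving colorings into a solution.  Weights are then found by fixing one edge after the other and
  are verified before they are returned.

  Each round is a polynomial-time function of the state of the search.  Hence the state after \<open>K\<close> rounds
  has size at most \<open>n\<close> to a power that depends only on \<open>K\<close> (exponentially), which suffices for XP time.
\<close>

section \<open>Polynomial-time functions\<close>

text \<open>A boundary vertex of a class needs two numbers. Its guessed final color makes the
  inequalities on edges checkable locally; the contribution of the class is what remains to be added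
  up. Classes consist of edges because contributions of disjoint edge sets simply add. Colors and
  contributions never exceed the number of edges. Hence they are tuples over the same range as
  padded vertex tuples, and one universe of tuples of length \<open>K\<close> serves for all three.
  A tuple may have many classes around it, and a contribution for each cannot be chosen by
  enumeration; as in subset sum, only the reachable totals are recorded. Treewidth enters a single
  claim, namely that the search stops at the latest when \<open>K\<close> is the treewidth plus 1,
  the largest bag size that an optimal decomposition can have. A decomposition thus has to exist but
  need not be programmed and timed. The exponent becomes exponential in \<open>K\<close> because
  \<open>polytime\<close> only provides some degree \<open>c\<close> for a round, and iterating a
  function of degree \<open>c\<close> gives degree \<open>c ^ K\<close>. XP allows this as long as
  the exponent is computable.\<close>

class enc = fixes enc :: "'a \<Rightarrow> val"

instantiation unit :: enc begin
definition "enc (x :: unit) = Null"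
instance ..
end

instantiation nat :: enc begin
definition "enc = encode_nat"
instance ..
end

instantiation bool :: enc begin
definition "enc = encode_bool"
instance ..
end

instantiation prod :: (enc, enc) enc begin
definition "enc p = Pair (enc (fst p)) (enc (snd p))"
instance ..
end

instantiation list :: (enc) enc begin
definition "enc xs = encode_list (map enc xs)"
instance ..
end

instantiation option :: (enc) enc begin
definition "enc x = (case x of None \<Rightarrow> Null | Some y \<Rightarrow> Pair Null (enc y))"
instance ..
end

lemma enc_simps [simp]:
  "enc () = Null"
  "enc (0::nat) = Null"
  "enc (Suc n) = Pair Null (enc n)"
  "enc False = Null"
  "enc True = Pair Null Null"
  "enc (a, b) = Pair (enc a) (enc b)"
  "enc [] = Null"
  "enc (x # xs) = Pair (enc x) (enc xs)"
  "enc None = Null"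
  "enc (Some y) = Pair Null (enc y)"
  by (simp_all add: enc_unit_def enc_nat_def enc_bool_def enc_prod_def enc_list_def enc_option_def
      encode_nat_def)

text \<open>The leaves have size 2 so that all sizes are at least 2 and sums of powers are dominated by powers.\<close>

primrec vsize :: "val \<Rightarrow> nat" where
  "vsize Null = 2"
| "vsize (Pair a b) = vsize a + vsize b + 1"

lemma vsize_ge: "2 \<le> vsize v"
  by (induction v) auto

definition sz :: "'a::enc \<Rightarrow> nat" where
  "sz x = vsize (enc x)"

lemma sz_ge: "2 \<le> sz x"
  by (simp add: sz_def vsize_ge)

lemma sz_pos [simp]: "0 < sz x" "Suc 0 \<le> sz x"
  using sz_ge[of x] by auto

lemma sz_simps [simp]:
  "sz () = 2"
  "sz (0::nat) = 2"
  "sz (Suc n) = sz n + 3"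
  "sz False = 2"
  "sz True = 5"
  "sz (a, b) = sz a + sz b + 1"
  "sz [] = 2"
  "sz (x # xs) = sz x + sz xs + 1"
  "sz None = 2"
  "sz (Some y) = sz y + 3"
  by (simp_all add: sz_def)

lemma sz_bool_le: "sz (b::bool) \<le> 5"
  by (cases b) auto

section \<open>Polynomial bounds in the size of an encoded value\<close>

definition polybd :: "('a::enc \<Rightarrow> nat) \<Rightarrow> bool" where
  "polybd g \<longleftrightarrow> (\<exists>c. \<forall>x. g x \<le> sz x ^ c)"

lemma pow_mono_sz: "c \<le> d \<Longrightarrow> sz x ^ c \<le> sz x ^ d"
  by (simp add: power_increasing)

lemma polybd_mono: "polybd g \<Longrightarrow> (\<And>x. h x \<le> g x) \<Longrightarrow> polybd h"
  unfolding polybd_def by (meson order_trans)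

lemma polybd_const [intro!]: "polybd (\<lambda>_. k)"
proof -
  have "k \<le> sz x ^ k" for x :: 'a
  proof -
    have "k \<le> 2 ^ k" by (simp add: less_imp_le)
    also have "\<dots> \<le> sz x ^ k" using sz_ge by (rule power_mono) simp
    finally show ?thesis .
  qed
  then show ?thesis unfolding polybd_def by blast
qed

lemma polybd_sz [intro!]: "polybd sz"
  unfolding polybd_def by (rule exI[of _ 1]) simp

lemma polybd_mult [intro!]: "polybd g \<Longrightarrow> polybd h \<Longrightarrow> polybd (\<lambda>x. g x * h x)"
  unfolding polybd_def
proof (elim exE)
  fix c d assume "\<forall>x. g x \<le> sz x ^ c" "\<forall>x. h x \<le> sz x ^ d"
  then have "\<forall>x. g x * h x \<le> sz x ^ (c + d)" by (simp add: power_add mult_le_mono)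
  then show "\<exists>c. \<forall>x. g x * h x \<le> sz x ^ c" by blast
qed

lemma polybd_add [intro!]: "polybd g \<Longrightarrow> polybd h \<Longrightarrow> polybd (\<lambda>x. g x + h x)"
proof -
  assume "polybd g" "polybd h"
  have "polybd (\<lambda>x. f x + 1)" if f: "polybd f" for f :: "'a \<Rightarrow> nat"
  proof -
    from f obtain c where c: "\<And>x. f x \<le> sz x ^ c" unfolding polybd_def by blast
    have "f x + 1 \<le> sz x ^ (c + 1)" for x
    proof -
      have "f x + 1 \<le> sz x ^ c + sz x ^ c" using c[of x] by (intro add_mono) auto
      also have "\<dots> = 2 * sz x ^ c" by simp
      also have "\<dots> \<le> sz x * sz x ^ c" using sz_ge by (rule mult_le_mono1)
      finally show ?thesis by simp
    qed
    then show ?thesis unfolding polybd_def by blast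
  qed
  then have "polybd (\<lambda>x. (g x + 1) * (h x + 1))" using \<open>polybd g\<close> \<open>polybd h\<close> by (intro polybd_mult)
  then show ?thesis by (rule polybd_mono) simp
qed

lemma polybd_Suc [intro!]: "polybd g \<Longrightarrow> polybd (\<lambda>x. Suc (g x))"
  using polybd_add[of g "\<lambda>_. 1"] by auto

lemma polybd_pow [intro!]: "polybd g \<Longrightarrow> polybd (\<lambda>x. g x ^ c)"
  by (induction c) auto

lemma polybd_comp: "polybd g \<Longrightarrow> polybd (\<lambda>x. sz (f x)) \<Longrightarrow> polybd (\<lambda>x. g (f x))"
proof -
  assume "polybd g" and f: "polybd (\<lambda>x. sz (f x))"
  then obtain c where "\<And>x. g x \<le> sz x ^ c" unfolding polybd_def by blast
  moreover have "polybd (\<lambda>x. sz (f x) ^ c)" using f by auto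
  ultimately show ?thesis by (auto intro: polybd_mono)
qed

text \<open>The size of the result is a separate requirement, since time does not control it:
  \<open>Make_Pair Self Self\<close> doubles a value in constantly many steps, so sizes may grow
  exponentially with the running time.\<close>

definition polytime :: "('a::enc \<Rightarrow> 'b::enc) \<Rightarrow> bool" where
  "polytime f \<longleftrightarrow> polybd (\<lambda>x. sz (f x)) \<and>
     (\<exists>p \<tau>. polybd \<tau> \<and> (\<forall>x. exec p (enc x) (enc (f x)) (\<tau> x)))"

lemma polytime_I: "(\<And>x. exec p (enc x) (enc (f x)) (\<tau> x)) \<Longrightarrow> polybd \<tau> \<Longrightarrow> polybd (\<lambda>x. sz (f x)) \<Longrightarrow> polytime f"
  unfolding polytime_def by blast

lemma polytime_bd: "polytime f \<Longrightarrow> polybd (\<lambda>x. sz (f x))"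
  unfolding polytime_def by blast

named_theorems polytime_rules

lemmas exec_Suc = exec.intros[simplified]

lemma polytime_id [polytime_rules]: "polytime (\<lambda>x. x)"
  by (rule polytime_I[of Self _ "\<lambda>_. 1"]) (auto intro: exec.Self[simplified])

lemma exec_const: "\<exists>p t. \<forall>x. exec p x v t"
proof (induction v)
  case Null
  show ?case using exec.Const_Null by blast
next
  case (Pair a b)
  then show ?case by (meson exec.Make_Pair)
qed

lemma polytime_const [polytime_rules]: "polytime (\<lambda>_. k)"
proof -
  obtain p t where "\<And>x. exec p x (enc k) t" using exec_const by blast
  then show ?thesis by (intro polytime_I[of p _ "\<lambda>_. t"]) auto
qed

lemma polytime_comp:
  assumes "polytime f" "polytime g"
  shows "polytime (\<lambda>x. f (g x))"
proof -
  obtain p \<tau> where p: "\<And>x. exec p (enc x) (enc (f x)) (\<tau> x)" "polybd \<tau>" "polybd (\<lambda>x. sz (f x))"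
    using assms(1) unfolding polytime_def by blast
  obtain q \<rho> where q: "\<And>x. exec q (enc x) (enc (g x)) (\<rho> x)" "polybd \<rho>" "polybd (\<lambda>x. sz (g x))"
    using assms(2) unfolding polytime_def by blast
  show ?thesis
  proof (rule polytime_I)
    show "exec (Seq q p) (enc x) (enc (f (g x))) (\<rho> x + \<tau> (g x) + 1)" for x
      using p q by (auto intro: exec_Suc)
    show "polybd (\<lambda>x. \<rho> x + \<tau> (g x) + 1)" using p q by (auto intro: polybd_comp[of \<tau>])
    show "polybd (\<lambda>x. sz (f (g x)))" using polybd_comp[of "\<lambda>x. sz (f x)" g] p q by auto
  qed
qed

lemma polytime_Pair [polytime_rules]:
  assumes "polytime f" "polytime g"
  shows "polytime (\<lambda>x. (f x, g x))"
proof -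
  obtain p \<tau> where p: "\<And>x. exec p (enc x) (enc (f x)) (\<tau> x)" "polybd \<tau>" "polybd (\<lambda>x. sz (f x))"
    using assms(1) unfolding polytime_def by blast
  obtain q \<rho> where q: "\<And>x. exec q (enc x) (enc (g x)) (\<rho> x)" "polybd \<rho>" "polybd (\<lambda>x. sz (g x))"
    using assms(2) unfolding polytime_def by blast
  show ?thesis
    by (rule polytime_I[of "Make_Pair p q" _ "\<lambda>x. \<tau> x + \<rho> x + 1"]) (use p q in \<open>auto intro: exec_Suc\<close>)
qed

lemma polytime_If [polytime_rules]:
  assumes "polytime b" "polytime f" "polytime g"
  shows "polytime (\<lambda>x. if b x then f x else g x)"
proof -
  obtain p \<tau> where p: "\<And>x. exec p (enc x) (enc (f x)) (\<tau> x)" "polybd \<tau>" "polybd (\<lambda>x. sz (f x))"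
    using assms(2) unfolding polytime_def by blast
  obtain q \<rho> where q: "\<And>x. exec q (enc x) (enc (g x)) (\<rho> x)" "polybd \<rho>" "polybd (\<lambda>x. sz (g x))"
    using assms(3) unfolding polytime_def by blast
  obtain r \<sigma> where r: "\<And>x. exec r (enc x) (enc (b x)) (\<sigma> x)" "polybd \<sigma>"
    using assms(1) unfolding polytime_def by blast
  show ?thesis
  proof (rule polytime_I)
    show "exec (Cond r p q) (enc x) (enc (if b x then f x else g x))
        (\<sigma> x + (if b x then \<tau> x else \<rho> x) + 1)" for x
      using p(1)[of x] q(1)[of x] r(1)[of x] by (cases "b x") (auto intro: exec_Suc)
    have "polybd (\<lambda>x. \<sigma> x + (\<tau> x + \<rho> x) + 1)" using p q r by auto
    then show "polybd (\<lambda>x. \<sigma> x + (if b x then \<tau> x else \<rho> x) + 1)" by (rule polybd_mono) auto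
    have "polybd (\<lambda>x. sz (f x) + sz (g x))" using p q by auto
    then show "polybd (\<lambda>x. sz (if b x then f x else g x))" by (rule polybd_mono) auto
  qed
qed

lemma polytime_prim:
  assumes "\<And>x. exec p (enc x) (enc (f x)) 1" "\<And>x. sz (f x) \<le> sz x"
  shows "polytime f"
proof (rule polytime_I[of p _ "\<lambda>_. 1"])
  show "polybd (\<lambda>x. sz (f x))" using polybd_sz assms(2) by (rule polybd_mono)
qed (use assms in auto)

lemma polytime_fst [polytime_rules]:
  fixes f :: "'a::enc \<Rightarrow> 'b::enc \<times> 'c::enc"
  assumes "polytime f" shows "polytime (\<lambda>x. fst (f x))"
proof (rule polytime_comp[OF _ assms])
  show "polytime (fst :: 'b \<times> 'c \<Rightarrow> 'b)"
    by (rule polytime_prim[of First]) (auto intro: exec_Suc)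
qed

lemma polytime_snd [polytime_rules]:
  fixes f :: "'a::enc \<Rightarrow> 'b::enc \<times> 'c::enc"
  assumes "polytime f" shows "polytime (\<lambda>x. snd (f x))"
proof (rule polytime_comp[OF _ assms])
  show "polytime (snd :: 'b \<times> 'c \<Rightarrow> 'c)"
    by (rule polytime_prim[of Second]) (auto intro: exec_Suc)
qed

lemma polytime_tl [polytime_rules]:
  fixes f :: "'a::enc \<Rightarrow> 'b::enc list"
  assumes "polytime f" shows "polytime (\<lambda>x. tl (f x))"
proof (rule polytime_comp[OF _ assms])
  have "exec Second (enc xs) (enc (tl xs)) 1" for xs :: "'b list"
    by (cases xs) (auto intro: exec_Suc)
  moreover have "sz (tl xs) \<le> sz xs" for xs :: "'b list" by (cases xs) auto
  ultimately show "polytime (tl :: 'b list \<Rightarrow> 'b list)" by (intro polytime_prim)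
qed

text \<open>\<open>x # xs\<close>, \<open>Suc n\<close> and \<open>Some y\<close> are encoded like
  suitable pairs, so pairing programs compute them too.\<close>

lemma polytime_retype:
  assumes "polytime f" "\<And>x. enc (g x) = enc (f x)"
  shows "polytime g"
proof -
  have "sz (g x) = sz (f x)" for x using assms(2) by (simp add: sz_def)
  with assms show ?thesis unfolding polytime_def by simp
qed

lemma polytime_Cons [polytime_rules]: "polytime f \<Longrightarrow> polytime g \<Longrightarrow> polytime (\<lambda>x. f x # g x)"
  by (rule polytime_retype[OF polytime_Pair]) auto

lemma polytime_Suc [polytime_rules]:
  assumes "polytime f" shows "polytime (\<lambda>x. Suc (f x))"
proof (rule polytime_retype)
  show "polytime (\<lambda>x. ((), f x))" using assms by (intro polytime_rules)
qed simp

lemma polytime_Some [polytime_rules]: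
  assumes "polytime f" shows "polytime (\<lambda>x. Some (f x))"
proof (rule polytime_retype)
  show "polytime (\<lambda>x. ((), f x))" using assms by (intro polytime_rules)
qed simp

lemma polytime_Not [polytime_rules]:
  assumes "polytime b" shows "polytime (\<lambda>x. \<not> b x)"
proof -
  have "polytime (\<lambda>x. if b x then False else True)" using assms by (intro polytime_rules)
  moreover have "(\<lambda>x. if b x then False else True) = (\<lambda>x. \<not> b x)" by auto
  ultimately show ?thesis by simp
qed

lemma polytime_conj [polytime_rules]:
  assumes "polytime a" "polytime b" shows "polytime (\<lambda>x. a x \<and> b x)"
proof -
  have "polytime (\<lambda>x. if a x then b x else False)" using assms by (intro polytime_rules)
  moreover have "(\<lambda>x. if a x then b x else False) = (\<lambda>x. a x \<and> b x)" by auto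
  ultimately show ?thesis by simp
qed

lemma polytime_disj [polytime_rules]: "polytime a \<Longrightarrow> polytime b \<Longrightarrow> polytime (\<lambda>x. a x \<or> b x)"
  using polytime_Not[OF polytime_conj[OF polytime_Not polytime_Not], of a b] by simp

lemma polytime_imp [polytime_rules]: "polytime a \<Longrightarrow> polytime b \<Longrightarrow> polytime (\<lambda>x. a x \<longrightarrow> b x)"
  unfolding imp_conv_disj by (intro polytime_disj polytime_Not)

lemma polytime_Nil_eq [polytime_rules]:
  assumes "polytime f" shows "polytime (\<lambda>x. f x = [])"
proof -
  obtain p \<tau> where p: "\<And>x. exec p (enc x) (enc (f x)) (\<tau> x)" "polybd \<tau>" "polybd (\<lambda>x. sz (f x))"
    using assms unfolding polytime_def by blast
  let ?r = "Cond p Const_Null (Make_Pair Const_Null Const_Null)"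
  show ?thesis
  proof (rule polytime_I)
    show "exec ?r (enc x) (enc (f x = [])) (\<tau> x + (if f x = [] then 1 + 1 + 1 else 1) + 1)" for x
    proof (cases "f x")
      case Nil
      then show ?thesis
        using p(1)[of x] exec.Cond_False[OF _ exec.Make_Pair[OF exec.Const_Null exec.Const_Null]]
        by fastforce
    next
      case (Cons a l)
      then show ?thesis
        using p(1)[of x] exec.Cond_True[OF _ _ exec.Const_Null] by fastforce
    qed
    have "polybd (\<lambda>x. \<tau> x + 5)" using p by auto
    then show "polybd (\<lambda>x. \<tau> x + (if f x = [] then 1 + 1 + 1 else 1) + 1)" by (rule polybd_mono) auto
    show "polybd (\<lambda>x. sz (f x = []))" using polybd_const[of 5] by (rule polybd_mono) (rule sz_bool_le)
  qed
qed

lemma polytime_I_le: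
  assumes "\<And>x. \<exists>t. exec p (enc x) (enc (f x)) t \<and> t \<le> g x" "polybd g" "polybd (\<lambda>x. sz (f x))"
  shows "polytime f"
proof -
  obtain \<tau> where \<tau>: "\<And>x. exec p (enc x) (enc (f x)) (\<tau> x) \<and> \<tau> x \<le> g x"
    using assms(1) by metis
  then have "polybd \<tau>" using assms(2) by (blast intro: polybd_mono)
  with \<tau> assms(3) show ?thesis by (blast intro: polytime_I)
qed

section \<open>Folds over lists\<close>

lemma sz_mem: "y \<in> set ys \<Longrightarrow> sz y \<le> sz ys"
  by (induction ys) auto

lemma length_le_sz: "length ys \<le> sz ys"
  by (induction ys) auto

text \<open>One iteration of the loop. The state consists of the parameter \<open>x\<close>, the
  rest of the list and the accumulator; the body pops the head \<open>y\<close> and regroups the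
  data as \<open>(x, a, y)\<close>, the input format of \<open>q\<close>.\<close>

definition foldl_body :: "prog \<Rightarrow> prog" where
  "foldl_body q = Make_Pair First (Make_Pair (Seq Second (Seq First Second))
     (Seq (Make_Pair First (Make_Pair (Seq Second Second) (Seq Second (Seq First First)))) q))"

lemma exec_foldl_body:
  assumes "exec q (enc (x, a, y)) (enc b) t"
  shows "exec (foldl_body q) (enc (x, y # ys, a)) (enc (x, ys, b)) (t + 20)"
proof -
  let ?v = "enc (x, y # ys, a)"
  have u1: "exec (Seq Second (Seq First Second)) ?v (enc ys) (1 + (1 + 1 + 1) + 1)"
    unfolding enc_simps by (rule exec.Seq[OF exec.Second_Pair exec.Seq[OF exec.First_Pair exec.Second_Pair]])
  have u2: "exec (Make_Pair First (Make_Pair (Seq Second Second) (Seq Second (Seq First First))))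
      ?v (enc (x, a, y)) (1 + ((1 + 1 + 1) + (1 + (1 + 1 + 1) + 1) + 1) + 1)"
    unfolding enc_simps
    by (rule exec.Make_Pair[OF exec.First_Pair exec.Make_Pair[OF exec.Seq[OF exec.Second_Pair exec.Second_Pair]
        exec.Seq[OF exec.Second_Pair exec.Seq[OF exec.First_Pair exec.First_Pair]]]])
  have u3: "exec First ?v (enc x) 1" unfolding enc_simps by (rule exec.First_Pair)
  have "exec (foldl_body q) ?v (Pair (enc x) (Pair (enc ys) (enc b)))
      (1 + ((1 + (1 + 1 + 1) + 1)
         + ((1 + ((1 + 1 + 1) + (1 + (1 + 1 + 1) + 1) + 1) + 1) + t + 1) + 1) + 1)"
    unfolding foldl_body_def by (rule exec.Make_Pair[OF u3 exec.Make_Pair[OF u1 exec.Seq[OF u2 assms]]])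
  then show ?thesis by (simp add: eval_nat_numeral)
qed

text \<open>\<open>M\<close> has to bound the step times only at accumulators that actually occur.
  The 24 consists of 20 for the body, 3 for the test and 1 for \<open>While\<close>; the 4 pays for
  the final failing test.\<close>

lemma exec_foldl_loop:
  assumes q: "\<And>a y. exec q (enc (x, a, y)) (enc (step a y)) (\<tau> (x, a, y))"
    and bd: "\<And>ys1 y ys2. ys = ys1 @ y # ys2 \<Longrightarrow> \<tau> (x, foldl step a ys1, y) \<le> M"
  shows "\<exists>t. exec (While (Seq Second First) (foldl_body q)) (enc (x, ys, a)) (enc (x, [] :: 'c::enc list, foldl step a ys)) t
     \<and> t \<le> length ys * (M + 24) + 4"
  using bd
proof (induction ys arbitrary: a)
  case Nil
  have "exec (Seq Second First) (enc (x, [] :: 'c list, a)) Null (1 + 1 + 1)"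
    unfolding enc_simps by (rule exec.Seq[OF exec.Second_Pair exec.First_Pair])
  then have "exec (While (Seq Second First) (foldl_body q)) (enc (x, [] :: 'c list, a)) (enc (x, [] :: 'c list, a)) (1 + 1 + 1 + 1)"
    by (rule exec.While_False)
  then show ?case by (auto simp: eval_nat_numeral)
next
  case (Cons y ys)
  have "\<tau> (x, foldl step (step a y) ys1, z) \<le> M" if "ys = ys1 @ z # ys2" for ys1 z ys2
    using Cons.prems[of "y # ys1" z ys2] that by simp
  then obtain t where t: "exec (While (Seq Second First) (foldl_body q)) (enc (x, ys, step a y))
      (enc (x, [] :: 'c list, foldl step (step a y) ys)) t" "t \<le> length ys * (M + 24) + 4"
    using Cons.IH by blast
  have "exec (Seq Second First) (enc (x, y # ys, a)) (Pair (enc y) (enc ys)) (1 + 1 + 1)"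
    unfolding enc_simps by (rule exec.Seq[OF exec.Second_Pair exec.First_Pair])
  from exec.While_True[OF this _ exec_foldl_body[OF q] t(1)]
  have "exec (While (Seq Second First) (foldl_body q)) (enc (x, y # ys, a))
      (enc (x, [] :: 'c list, foldl step (step a y) ys)) (1 + 1 + 1 + (\<tau> (x, a, y) + 20) + t + 1)"
    by simp
  moreover have "\<tau> (x, a, y) \<le> M" using Cons.prems[of "[]" y ys] by simp
  ultimately show ?case using t(2) by (intro exI conjI) (auto simp del: enc_simps)
qed

lemma sz_foldl_le:
  assumes "\<And>a y. y \<in> set ys \<Longrightarrow> sz (step a y) \<le> sz a + d"
  shows "sz (foldl step a ys) \<le> sz a + length ys * d"
  using assms
proof (induction ys arbitrary: a)
  case (Cons y ys)
  have "sz (foldl step (step a y) ys) \<le> sz (step a y) + length ys * d"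
    using Cons by auto
  moreover have "sz (step a y) \<le> sz a + d" using Cons.prems by simp
  ultimately show ?case by simp
qed simp

text \<open>The growth of the accumulator in one step may depend on the parameter and the list
  element, but not on the accumulator. Doubling it would be polynomial in one step and exponential
  over the list.\<close>

lemma polytime_foldl:
  fixes step :: "'a::enc \<Rightarrow> 'b::enc \<Rightarrow> 'c::enc \<Rightarrow> 'b"
  assumes step: "polytime (\<lambda>p. step (fst p) (fst (snd p)) (snd (snd p)))"
    and init: "polytime init" and l: "polytime l"
    and grow: "\<And>x a y. sz (step x a y) \<le> sz a + sz (x, y) ^ c"
  shows "polytime (\<lambda>x. foldl (step x) (init x) (l x))"
proof -
  obtain q \<tau> where q: "\<And>p. exec q (enc p) (enc (step (fst p) (fst (snd p)) (snd (snd p)))) (\<tau> p)"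
      and "polybd \<tau>"
    using step unfolding polytime_def by blast
  then obtain k where k: "\<And>p. \<tau> p \<le> sz p ^ k" unfolding polybd_def by blast
  obtain pi \<tau>i where pi: "\<And>x. exec pi (enc x) (enc (init x)) (\<tau>i x)" "polybd \<tau>i"
    using init unfolding polytime_def by blast
  obtain pl \<tau>l where pl: "\<And>x. exec pl (enc x) (enc (l x)) (\<tau>l x)" "polybd \<tau>l"
    using l unfolding polytime_def by blast
  \<comment> \<open>\<open>D\<close> bounds the growth in one step, \<open>S\<close> the accumulator
    after any prefix of the list, \<open>M\<close> the time of any step.\<close>
  define D where "D x = (sz x + sz (l x) + 1) ^ c" for x
  define S where "S x = sz (init x) + sz (l x) * D x" for x
  define M where "M x = (sz x + S x + sz (l x) + 2) ^ k" for x
  have bd [intro!]: "polybd D" "polybd S" "polybd M" "polybd (\<lambda>x. sz (l x))" "polybd (\<lambda>x. sz (init x))"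
    unfolding D_def S_def M_def using polytime_bd[OF init] polytime_bd[OF l] by auto
  have grow': "sz (step x a y) \<le> sz a + D x" if "y \<in> set (l x)" for x a y
  proof -
    have "sz (x, y) ^ c \<le> D x"
      unfolding D_def using sz_mem[OF that] by (intro power_mono) auto
    then show ?thesis using grow[of x a y] by linarith
  qed
  have S: "sz (foldl (step x) (init x) ys) \<le> S x" if "set ys \<subseteq> set (l x)" "length ys \<le> length (l x)" for x ys
  proof -
    have "sz (foldl (step x) (init x) ys) \<le> sz (init x) + length ys * D x"
      using grow' that by (intro sz_foldl_le) auto
    also have "\<dots> \<le> S x"
      unfolding S_def using that length_le_sz[of "l x"] by (intro add_left_mono mult_right_mono) auto
    finally show ?thesis .
  qed
  have M: "\<tau> (x, foldl (step x) (init x) ys1, y) \<le> M x" if "l x = ys1 @ y # ys2" for x ys1 y ys2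
  proof -
    have "sz (foldl (step x) (init x) ys1) \<le> S x" "sz y \<le> sz (l x)"
      using that by (auto intro!: S sz_mem)
    then have "sz (x, foldl (step x) (init x) ys1, y) ^ k \<le> M x"
      unfolding M_def by (intro power_mono) auto
    with k show ?thesis by (rule order_trans)
  qed
  let ?W = "While (Seq Second First) (foldl_body q)"
  let ?P = "Seq (Make_Pair Self (Make_Pair pl pi)) (Seq ?W (Seq Second Second))"
  let ?g = "\<lambda>x. 1 + (\<tau>l x + \<tau>i x + 1) + 1 + ((sz (l x) * (M x + 24) + 4) + (1 + 1 + 1) + 1) + 1"
  show ?thesis
  proof (rule polytime_I_le)
    fix x
    obtain t where t: "exec ?W (enc (x, l x, init x)) (enc (x, [] :: 'c list, foldl (step x) (init x) (l x))) t"
        "t \<le> length (l x) * (M x + 24) + 4"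
      using exec_foldl_loop[of q x "step x" \<tau> "l x" "init x" "M x"] q[of "(x, _, _)"] M by auto
    have 1: "exec (Make_Pair Self (Make_Pair pl pi)) (enc x) (enc (x, l x, init x)) (1 + (\<tau>l x + \<tau>i x + 1) + 1)"
      unfolding enc_simps by (intro exec.Make_Pair exec.Self pl pi)
    have 2: "exec (Seq Second Second) (enc (x, [] :: 'c list, foldl (step x) (init x) (l x))) (enc (foldl (step x) (init x) (l x))) (1 + 1 + 1)"
      unfolding enc_simps by (rule exec.Seq[OF exec.Second_Pair exec.Second_Pair])
    have "t \<le> sz (l x) * (M x + 24) + 4"
      using t(2) length_le_sz[of "l x"] by (meson add_le_mono1 mult_le_mono1 order_trans)
    then have "1 + (\<tau>l x + \<tau>i x + 1) + 1 + (t + (1 + 1 + 1) + 1) + 1 \<le> ?g x" by simp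
    with exec.Seq[OF 1 exec.Seq[OF t(1) 2]]
    show "\<exists>t. exec ?P (enc x) (enc (foldl (step x) (init x) (l x))) t \<and> t \<le> ?g x" by blast
  next
    show "polybd ?g" by (intro polybd_add polybd_mult polybd_const bd pl pi)
    show "polybd (\<lambda>x. sz (foldl (step x) (init x) (l x)))"
      using bd(2) S by (rule polybd_mono) auto
  qed
qed

lemma polytime_foldl':
  fixes step :: "'a::enc \<Rightarrow> 'b::enc \<Rightarrow> 'c::enc \<Rightarrow> 'b"
  assumes step: "polytime (\<lambda>p. step (fst p) (fst (snd p)) (snd (snd p)))"
    and init: "polytime init" and l: "polytime l"
    and grow: "\<And>x a y. sz (step x a y) \<le> sz a + g (x, y)" "polybd g"
  shows "polytime (\<lambda>x. foldl (step x) (init x) (l x))"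
proof -
  obtain c where "\<And>p. g p \<le> sz p ^ c" using grow(2) unfolding polybd_def by blast
  then have "sz (step x a y) \<le> sz a + sz (x, y) ^ c" for x a y
    using grow(1)[of x a y] by (meson add_left_mono order_trans)
  then show ?thesis using assms by (intro polytime_foldl) auto
qed

lemma polytime_comp2:
  assumes "polytime (\<lambda>p. f (fst p) (snd p))" "polytime a" "polytime b"
  shows "polytime (\<lambda>x. f (a x) (b x))"
  using polytime_comp[OF assms(1) polytime_Pair[OF assms(2,3)]] by simp

lemma polytime_comp3:
  assumes "polytime (\<lambda>p. f (fst p) (fst (snd p)) (snd (snd p)))" "polytime a" "polytime b" "polytime c"
  shows "polytime (\<lambda>x. f (a x) (b x) (c x))"
  using polytime_comp[OF assms(1) polytime_Pair[OF assms(2) polytime_Pair[OF assms(3,4)]]] by simp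

section \<open>List operations as folds\<close>

lemma polytime_list_ex [polytime_rules]:
  assumes P: "polytime (\<lambda>p. P (fst p) (snd p))" and l: "polytime l"
  shows "polytime (\<lambda>x. list_ex (P x) (l x))"
proof -
  have "polytime (\<lambda>x. foldl (\<lambda>a y. if a then True else P x y) False (l x))"
  proof (rule polytime_foldl')
    show "polytime (\<lambda>p. if fst (snd p) then True else P (fst p) (snd (snd p)))"
      by (intro polytime_rules polytime_comp2[OF P])
    show "sz (if a then True else P x y) \<le> sz a + 5" for a x y
      using sz_bool_le[of "if a then True else P x y"] by linarith
  qed (auto intro: polytime_const l)
  moreover have "foldl (\<lambda>a y. if a then True else P x y) b ys = (b \<or> list_ex (P x) ys)" for x b ys
    by (induction ys arbitrary: b) auto
  ultimately show ?thesis by simp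
qed

lemma polytime_list_all [polytime_rules]:
  assumes P: "polytime (\<lambda>p. P (fst p) (snd p))" and l: "polytime l"
  shows "polytime (\<lambda>x. list_all (P x) (l x))"
proof -
  have "polytime (\<lambda>x. \<not> list_ex (\<lambda>y. \<not> P x y) (l x))"
    by (intro polytime_rules P l)
  then show ?thesis by (simp add: list_all_iff list_ex_iff)
qed

lemma polytime_rev [polytime_rules]:
  assumes "polytime l" shows "polytime (\<lambda>x. rev (l x))"
proof -
  have "polytime (\<lambda>x. foldl (\<lambda>a y. y # a) [] (l x))"
    by (rule polytime_foldl'[where g = "\<lambda>p. sz p"]) (auto intro!: polytime_rules assms)
  then show ?thesis by (simp add: foldl_conv_fold flip: rev_conv_fold)
qed

lemma polytime_append [polytime_rules]:
  assumes "polytime l" "polytime m" shows "polytime (\<lambda>x. l x @ m x)"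
proof -
  have "polytime (\<lambda>x. foldl (\<lambda>a y. y # a) (m x) (rev (l x)))"
    by (rule polytime_foldl'[where g = "\<lambda>p. sz p"]) (auto intro!: polytime_rules assms)
  moreover have "foldl (\<lambda>a y. y # a) m l = rev l @ m" for m l :: "'b list"
    by (induction l arbitrary: m) auto
  ultimately show ?thesis by simp
qed

lemma polytime_map [polytime_rules]:
  assumes g: "polytime (\<lambda>p. g (fst p) (snd p))" and l: "polytime l"
  shows "polytime (\<lambda>x. map (g x) (l x))"
proof -
  have "polytime (\<lambda>x. foldl (\<lambda>a y. g x y # a) [] (l x))"
  proof (rule polytime_foldl')
    show "polybd (\<lambda>p. Suc (sz (g (fst p) (snd p))))" using polytime_bd[OF g] by auto
  qed (auto intro!: polytime_rules l polytime_comp2[OF g])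
  then have "polytime (\<lambda>x. rev (foldl (\<lambda>a y. g x y # a) [] (l x)))" by (rule polytime_rev)
  moreover have "foldl (\<lambda>a y. g x y # a) m ys = rev (map (g x) ys) @ m" for x m ys
    by (induction ys arbitrary: m) auto
  ultimately show ?thesis by simp
qed

lemma polytime_filter [polytime_rules]:
  assumes P: "polytime (\<lambda>p. P (fst p) (snd p))" and l: "polytime l"
  shows "polytime (\<lambda>x. filter (P x) (l x))"
proof -
  have "polytime (\<lambda>x. foldl (\<lambda>a y. if P x y then y # a else a) [] (l x))"
    by (rule polytime_foldl'[where g = "\<lambda>p. sz p"]) (auto intro!: polytime_rules l polytime_comp2[OF P])
  then have "polytime (\<lambda>x. rev (foldl (\<lambda>a y. if P x y then y # a else a) [] (l x)))" by (rule polytime_rev)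
  moreover have "foldl (\<lambda>a y. if P x y then y # a else a) m ys = rev (filter (P x) ys) @ m" for x m ys
    by (induction ys arbitrary: m) auto
  ultimately show ?thesis by simp
qed

lemma sz_append: "sz (xs @ ys) + 2 = sz xs + sz ys"
  by (induction xs) auto

lemma polytime_concat [polytime_rules]:
  assumes "polytime l" shows "polytime (\<lambda>x. concat (l x))"
proof -
  have "polytime (\<lambda>x. foldl (\<lambda>a y. a @ y) [] (l x))"
  proof (rule polytime_foldl'[where g = "\<lambda>p. sz p"])
    show "sz (a @ y) \<le> sz a + sz (x, y)" for a y :: "'b list" and x :: 'a
      using sz_append[of a y] by simp
  qed (auto intro!: polytime_rules assms)
  moreover have "foldl (\<lambda>a y. a @ y) m ys = m @ concat ys" for m :: "'b list" and ys
    by (induction ys arbitrary: m) auto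
  ultimately show ?thesis by simp
qed

text \<open>\<open>hd []\<close> is unspecified, but it is a fixed value with a fixed encoding,
  which the program can return as a constant.\<close>

lemma polytime_hd [polytime_rules]:
  fixes f :: "'a::enc \<Rightarrow> 'b::enc list"
  assumes "polytime f" shows "polytime (\<lambda>x. hd (f x))"
proof (rule polytime_comp[OF _ assms])
  obtain p t where p: "\<And>v. exec p v (enc (hd [] :: 'b)) t" using exec_const by blast
  show "polytime (hd :: 'b list \<Rightarrow> 'b)"
  proof (rule polytime_I_le)
    fix xs :: "'b list"
    show "\<exists>s. exec (Cond Self First p) (enc xs) (enc (hd xs)) s \<and> s \<le> t + 3"
    proof (cases xs)
      case Nil
      have "exec (Cond Self First p) (enc xs) (enc (hd xs)) (1 + t + 1)"
        using Nil p exec.Self[of Null] by (intro exec.Cond_False) auto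
      then show ?thesis by (intro exI conjI, assumption) simp
    next
      case (Cons y ys)
      have "exec (Cond Self First p) (enc xs) (enc (hd xs)) (1 + 1 + 1)"
        using Cons exec.Self[of "enc xs"] exec.First_Pair[of "enc y" "enc ys"]
        by (intro exec.Cond_True) auto
      then show ?thesis by (intro exI conjI, assumption) simp
    qed
  next
    have "sz (hd xs) \<le> sz xs + sz (hd [] :: 'b)" for xs :: "'b list" by (cases xs) auto
    moreover have "polybd (\<lambda>xs :: 'b list. sz xs + sz (hd [] :: 'b))" by auto
    ultimately show "polybd (\<lambda>xs :: 'b list. sz (hd xs))" by (blast intro: polybd_mono)
  qed auto
qed

lemma polytime_case_list [polytime_rules]:
  assumes "polytime l" "polytime a" "polytime (\<lambda>p. b (fst p) (fst (snd p)) (snd (snd p)))"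
  shows "polytime (\<lambda>x. case l x of [] \<Rightarrow> a x | y # ys \<Rightarrow> b x y ys)"
proof -
  have "polytime (\<lambda>x. if l x = [] then a x else b x (hd (l x)) (tl (l x)))"
    by (intro polytime_rules polytime_comp3[OF assms(3)] assms)
  moreover have "(\<lambda>x. if l x = [] then a x else b x (hd (l x)) (tl (l x))) =
      (\<lambda>x. case l x of [] \<Rightarrow> a x | y # ys \<Rightarrow> b x y ys)"
    by (auto split: list.splits)
  ultimately show ?thesis by simp
qed

text \<open>The unread part of the first list is kept in the accumulator. Its head only moves from
  there to the output, so a step adds little more than the size of \<open>y\<close>.\<close>

lemma polytime_zip [polytime_rules]:
  assumes "polytime l" "polytime m" shows "polytime (\<lambda>x. zip (l x) (m x))"
proof -
  let ?step = "\<lambda>a y. if fst a = [] then a else (tl (fst a), (hd (fst a), y) # snd a)"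
  have "polytime (\<lambda>x. foldl ?step (l x, []) (m x))"
  proof (rule polytime_foldl'[where g = "\<lambda>p. sz p + 2"])
    show "sz (?step a y) \<le> sz a + (sz (x, y) + 2)" for x :: 'a and y :: 'c and a :: "'b list \<times> ('b \<times> 'c) list"
      by (cases a; cases "fst a") auto
  qed (auto intro!: polytime_rules assms)
  then have "polytime (\<lambda>x. rev (snd (foldl ?step (l x, []) (m x))))" by (intro polytime_rules)
  moreover have "snd (foldl ?step (xs, a) ys) = rev (zip xs ys) @ a"
    for xs :: "'b list" and ys :: "'c list" and a
  proof (induction ys arbitrary: xs a)
    case (Cons y ys)
    then show ?case by (cases xs) (auto simp: foldl_conv_fold)
  qed simp
  ultimately show ?thesis by simp
qed

lemma polytime_length [polytime_rules]:
  assumes "polytime l" shows "polytime (\<lambda>x. length (l x))"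
proof -
  have "polytime (\<lambda>x. foldl (\<lambda>a y. Suc a) 0 (l x))"
    by (rule polytime_foldl'[where g = "\<lambda>p. 3"]) (auto intro!: polytime_rules assms)
  moreover have "foldl (\<lambda>a y. Suc a) k ys = k + length ys" for k and ys :: "'b list"
    by (induction ys arbitrary: k) auto
  ultimately show ?thesis by simp
qed

text \<open>A unary number and a list of that many units have the same encoding, so list programs do
  the arithmetic.\<close>

lemma polytime_units:
  assumes "polytime f" shows "polytime (\<lambda>x. replicate (f x) ())"
proof (rule polytime_retype[OF assms])
  have "enc (replicate n ()) = enc n" for n by (induction n) auto
  then show "enc (replicate (f x) ()) = enc (f x)" for x .
qed

lemma polytime_pred:
  assumes "polytime f" shows "polytime (\<lambda>x. f x - Suc 0)"
proof -
  have "polytime (\<lambda>x. length (tl (replicate (f x) ())))" by (intro polytime_rules polytime_units assms)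
  then show ?thesis by simp
qed

lemma polytime_minus [polytime_rules]:
  assumes "polytime f" "polytime g" shows "polytime (\<lambda>x. f x - g x :: nat)"
proof -
  have "sz (a - Suc 0) \<le> sz a" for a by (cases a) auto
  then have "polytime (\<lambda>x. foldl (\<lambda>a y. a - Suc 0) (f x) (replicate (g x) ()))"
    by (intro polytime_foldl'[where g = "\<lambda>p. 0"]) (auto intro!: polytime_rules assms polytime_units polytime_pred)
  moreover have "foldl (\<lambda>a y. a - Suc 0) k (replicate m ()) = k - m" for k m
    by (induction m arbitrary: k) auto
  ultimately show ?thesis by simp
qed

lemma polytime_plus [polytime_rules]:
  assumes "polytime f" "polytime g" shows "polytime (\<lambda>x. f x + g x :: nat)"
proof -
  have "polytime (\<lambda>x. length (replicate (f x) () @ replicate (g x) ()))"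
    by (intro polytime_rules assms polytime_units)
  then show ?thesis by simp
qed

lemma polytime_less [polytime_rules]:
  assumes "polytime f" "polytime g" shows "polytime (\<lambda>x. (f x :: nat) < g x)"
proof -
  have "polytime (\<lambda>x. replicate (g x - f x) () \<noteq> [])"
    by (intro polytime_rules assms polytime_units)
  then show ?thesis by (simp add: replicate_empty not_le)
qed

lemma sz_nat: "sz (n :: nat) = 3 * n + 2"
  by (induction n) auto

lemma polytime_upt [polytime_rules]:
  assumes "polytime f" shows "polytime (\<lambda>x. [0..<f x])"
proof -
  \<comment> \<open>The guard bounds the growth of the accumulator for arbitrary values of the counter.\<close>
  let ?step = "\<lambda>n a (y :: unit). if fst a < n then (Suc (fst a), fst a # snd a) else a"
  have *: "foldl (?step n) (k, l) (replicate m ()) = (k + m, rev [k..<k + m] @ l)" if "k + m \<le> n" for k l m n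
    using that by (induction m arbitrary: k l) (auto simp: upt_conv_Cons simp del: upt_Suc)
  have "polytime (\<lambda>x. foldl (?step (f x)) (0, []) (replicate (f x) ()))"
  proof (rule polytime_foldl')
    show "polybd (\<lambda>p. sz (f (fst p)) + 4)" using polytime_bd[OF polytime_comp[OF assms polytime_fst[OF polytime_id]]] by auto
    show "sz (?step (f x) a y) \<le> sz a + (sz (f (fst (x, y))) + 4)" for x a and y :: unit
      by (cases a) (auto simp: sz_nat)
  qed (auto intro!: polytime_rules polytime_units polytime_comp[OF assms] assms)
  then have "polytime (\<lambda>x. rev (snd (foldl (?step (f x)) (0, []) (replicate (f x) ()))))" by (intro polytime_rules)
  then show ?thesis by (simp add: *)
qed

text \<open>Equality is attached to the type, so that nested types such as \<open>fact\<close> are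
  resolved by their structure.\<close>

definition polytime_eq_type :: "'a::enc itself \<Rightarrow> bool" where
  "polytime_eq_type _ \<longleftrightarrow> polytime (\<lambda>p :: 'a \<times> 'a. fst p = snd p)"

lemma polytime_eq [polytime_rules]:
  fixes f :: "'a::enc \<Rightarrow> 'b::enc"
  assumes "polytime_eq_type TYPE('b)" "polytime f" "polytime g" shows "polytime (\<lambda>x. f x = g x)"
  using polytime_comp[OF assms(1)[unfolded polytime_eq_type_def] polytime_Pair[OF assms(2,3)]] by simp

lemma polytime_eq_nat [polytime_rules]: "polytime_eq_type TYPE(nat)"
proof -
  have "polytime (\<lambda>p :: nat \<times> nat. \<not> fst p < snd p \<and> \<not> snd p < fst p)" by (intro polytime_rules)
  moreover have "(\<lambda>p :: nat \<times> nat. \<not> fst p < snd p \<and> \<not> snd p < fst p) = (\<lambda>p. fst p = snd p)" by auto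
  ultimately show ?thesis unfolding polytime_eq_type_def by simp
qed

lemma polytime_eq_bool [polytime_rules]: "polytime_eq_type TYPE(bool)"
proof -
  have "polytime (\<lambda>p. if fst p then snd p else \<not> snd p)" by (intro polytime_rules)
  moreover have "(\<lambda>p. if fst p then snd p else \<not> snd p) = (\<lambda>p. fst p = snd p)" by auto
  ultimately show ?thesis unfolding polytime_eq_type_def by simp
qed

lemma polytime_eq_prod [polytime_rules]:
  assumes "polytime_eq_type TYPE('a::enc)" "polytime_eq_type TYPE('b::enc)"
  shows "polytime_eq_type TYPE('a \<times> 'b)"
  unfolding polytime_eq_type_def prod_eq_iff by (intro polytime_rules assms)

lemma polytime_eq_list [polytime_rules]:
  assumes "polytime_eq_type TYPE('a::enc)" shows "polytime_eq_type TYPE('a list)"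
proof -
  have *: "xs = ys \<longleftrightarrow> length xs = length ys \<and> list_all (\<lambda>q. fst q = snd q) (zip xs ys)" for xs ys :: "'a list"
    by (auto simp: list_all_length intro: nth_equalityI)
  show ?thesis unfolding polytime_eq_type_def by (subst *) (intro polytime_rules assms)
qed

lemma polytime_member [polytime_rules]:
  fixes f :: "'a::enc \<Rightarrow> 'b::enc"
  assumes "polytime_eq_type TYPE('b)" "polytime f" "polytime l" shows "polytime (\<lambda>x. f x \<in> set (l x))"
proof -
  have "polytime (\<lambda>x. list_ex (\<lambda>y. y = f x) (l x))" by (intro polytime_rules polytime_comp[OF assms(2)] assms)
  then show ?thesis by (simp add: list_ex_iff)
qed

lemma polytime_ball [polytime_rules]:
  assumes "polytime (\<lambda>p. P (fst p) (snd p))" "polytime l"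
  shows "polytime (\<lambda>x. \<forall>y\<in>set (l x). P x y)"
  using polytime_list_all[OF assms] by (simp add: list_all_iff)

lemma polytime_bex [polytime_rules]:
  assumes "polytime (\<lambda>p. P (fst p) (snd p))" "polytime l"
  shows "polytime (\<lambda>x. \<exists>y\<in>set (l x). P x y)"
  using polytime_list_ex[OF assms] by (simp add: list_ex_iff)

lemma polytime_comp5:
  assumes "polytime (\<lambda>p. f (fst p) (fst (snd p)) (fst (snd (snd p))) (fst (snd (snd (snd p)))) (snd (snd (snd (snd p)))))"
    "polytime a" "polytime b" "polytime c" "polytime d" "polytime e"
  shows "polytime (\<lambda>x. f (a x) (b x) (c x) (d x) (e x))"
  using polytime_comp[OF assms(1) polytime_Pair[OF assms(2) polytime_Pair[OF assms(3) polytime_Pair[OF assms(4)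
        polytime_Pair[OF assms(5,6)]]]]] by simp

lemma polytime_comp7:
  assumes "polytime (\<lambda>p. f (fst p) (fst (snd p)) (fst (snd (snd p))) (fst (snd (snd (snd p))))
      (fst (snd (snd (snd (snd p))))) (fst (snd (snd (snd (snd (snd p)))))) (snd (snd (snd (snd (snd (snd p)))))))"
    "polytime a" "polytime b" "polytime c" "polytime d" "polytime e" "polytime g" "polytime h"
  shows "polytime (\<lambda>x. f (a x) (b x) (c x) (d x) (e x) (g x) (h x))"
  using polytime_comp[OF assms(1) polytime_Pair[OF assms(2) polytime_Pair[OF assms(3) polytime_Pair[OF assms(4)
        polytime_Pair[OF assms(5) polytime_Pair[OF assms(6) polytime_Pair[OF assms(7,8)]]]]]]] by simp

section \<open>The algorithm\<close>

type_synonym edge = "nat \<times> nat"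

text \<open>
  A fact \<open>((X, D), c, s)\<close> concerns a class \<open>D\<close> of edges that meets the rest of the graph only in the
  vertices of \<open>X\<close>; \<open>c\<close> lists the colors of the vertices of \<open>X\<close> and \<open>s\<close> the contributions of \<open>D\<close> to them.
\<close>

type_synonym fact = "(nat list \<times> edge list) \<times> nat list \<times> nat list"

definition inc :: "nat \<Rightarrow> edge \<Rightarrow> bool" where
  "inc v e \<longleftrightarrow> v = fst e \<or> v = snd e"

definition share :: "nat list \<Rightarrow> edge \<Rightarrow> edge \<Rightarrow> bool" where
  "share Y e e' \<longleftrightarrow> fst e \<notin> set Y \<and> inc (fst e) e' \<or> snd e \<notin> set Y \<and> inc (snd e) e'"

definition split_step :: "nat list \<Rightarrow> edge list list \<Rightarrow> edge \<Rightarrow> edge list list" where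
  "split_step Y ps e =
     (e # concat (filter (\<lambda>p. \<exists>e'\<in>set p. share Y e e') ps)) # filter (\<lambda>p. \<not> (\<exists>e'\<in>set p. share Y e e')) ps"

text \<open>The connected components of the edges when only vertices outside \<open>Y\<close>
  connect them, built by inserting edge after edge. An edge inside \<open>Y\<close> is a class of
  its own.\<close>

definition split :: "nat list \<Rightarrow> edge list \<Rightarrow> edge list list" where
  "split Y es = foldl (split_step Y) [] es"

text \<open>The classes are selected from the split of all edges and not computed from
  \<open>D\<close>, because facts are indexed by these very lists.\<close>

definition pieces :: "nat list \<Rightarrow> edge list \<Rightarrow> edge list \<Rightarrow> edge list list" where
  "pieces Y es D = filter (\<lambda>p. \<exists>e\<in>set p. e \<in> set D) (split Y es)"

text \<open>Reads \<open>u\<close> as a function on the entries of \<open>X\<close>. Conditions on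
  colors and contributions are stated through it, which admits tuples with repeated entries such as
  padded bags.\<close>

definition lookup :: "nat list \<Rightarrow> nat list \<Rightarrow> nat \<Rightarrow> nat" where
  "lookup X u x = (case filter (\<lambda>p. fst p = x) (zip X u) of [] \<Rightarrow> 0 | p # ps \<Rightarrow> snd p)"

definition allowed :: "(edge \<times> bool) list \<Rightarrow> edge \<Rightarrow> bool \<Rightarrow> bool" where
  "allowed fs e b \<longleftrightarrow> (\<forall>q\<in>set fs. fst q = e \<longrightarrow> snd q = b)"

text \<open>One step of a dynamic program in the style of subset sum. Enumerating a contribution for
  every class would take time exponential in the number of classes, which \<open>K\<close> does not
  bound.\<close>

definition sum_step :: "nat list list \<Rightarrow> fact list \<Rightarrow> nat list \<Rightarrow> nat list \<Rightarrow>
    nat list list \<Rightarrow> edge list \<Rightarrow> nat list list" where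
  "sum_step U T Y c A p = filter (\<lambda>u. \<exists>a\<in>set A. \<exists>s\<in>set U. ((Y, p), c, s) \<in> set T \<and>
     (\<forall>y\<in>set Y. lookup Y u y = lookup Y a y + lookup Y s y)) U"

definition sums :: "nat list list \<Rightarrow> fact list \<Rightarrow> nat list \<Rightarrow> nat list \<Rightarrow> edge list list \<Rightarrow> nat list list" where
  "sums U T Y c ps = foldl (sum_step U T Y c) (filter (\<lambda>u. \<forall>y\<in>set Y. lookup Y u y = 0) U) ps"

text \<open>Applied when all ends of \<open>D\<close> lie in \<open>X\<close>. Such a class is a
  single edge (\<open>covered_single\<close>), so one Boolean \<open>b\<close> is a complete weight
  assignment.\<close>

definition covered_ok :: "(edge \<times> bool) list \<Rightarrow> nat list \<Rightarrow> edge list \<Rightarrow> nat list \<Rightarrow> nat list \<Rightarrow> bool" where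
  "covered_ok fs X D c s \<longleftrightarrow> (\<exists>b\<in>set [False, True]. \<forall>e\<in>set D. allowed fs e b \<and>
     lookup X c (fst e) \<noteq> lookup X c (snd e) \<and>
     (\<forall>x\<in>set X. lookup X s x = (if b \<and> inc x e then 1 else 0)))"

text \<open>A vertex of \<open>X\<close> outside \<open>Y\<close> does not touch \<open>D\<close>
  and must receive 0 from it. A vertex of \<open>Y\<close> outside \<open>X\<close> that touches
  \<open>D\<close> has all its edges in \<open>D\<close>, so the total contribution must be its
  color.\<close>

definition split_ok :: "edge list \<Rightarrow> nat list list \<Rightarrow> fact list \<Rightarrow>
    nat list \<Rightarrow> edge list \<Rightarrow> nat list \<Rightarrow> nat list \<Rightarrow> bool" where
  "split_ok es U T X D c s \<longleftrightarrow> (\<forall>Y\<in>set U. (\<forall>x\<in>set X. (\<exists>e\<in>set D. inc x e) \<longrightarrow> x \<in> set Y) \<longrightarrow>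
     (\<exists>c'\<in>set U. (\<forall>x\<in>set X. x \<in> set Y \<longrightarrow> lookup Y c' x = lookup X c x) \<and>
       (\<exists>u\<in>set (sums U T Y c' (pieces Y es D)).
          (\<forall>x\<in>set X. lookup X s x = (if x \<in> set Y then lookup Y u x else 0)) \<and>
          (\<forall>y\<in>set Y. y \<notin> set X \<and> (\<exists>e\<in>set D. inc y e) \<longrightarrow> lookup Y u y = lookup Y c' y))))"

definition fact_ok :: "(edge \<times> bool) list \<Rightarrow> edge list \<Rightarrow> nat list list \<Rightarrow> fact list \<Rightarrow> fact \<Rightarrow> bool" where
  "fact_ok fs es U T f \<longleftrightarrow>
     (if \<forall>e\<in>set (snd (fst f)). fst e \<in> set (fst (fst f)) \<and> snd e \<in> set (fst (fst f))
      then covered_ok fs (fst (fst f)) (snd (fst f)) (fst (snd f)) (snd (snd f))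
      else split_ok es U T (fst (fst f)) (snd (fst f)) (fst (snd f)) (snd (snd f)))"

definition all_facts :: "edge list \<Rightarrow> nat list list \<Rightarrow> fact list" where
  "all_facts es U = concat (map (\<lambda>X. concat (map (\<lambda>D. concat (map (\<lambda>c.
     map (\<lambda>s. ((X, D), c, s)) U) U)) (split X es))) U)"

text \<open>The second copy of \<open>all_facts\<close> is a counter that is long enough to reach a
  fixed point of the deletion.\<close>

definition stable_facts :: "(edge \<times> bool) list \<Rightarrow> edge list \<Rightarrow> nat list list \<Rightarrow> fact list" where
  "stable_facts fs es U =
     foldl (\<lambda>T _. filter (fact_ok fs es U T) T) (all_facts es U) (all_facts es U)"

text \<open>The whole edge set is treated as one class with empty boundary.\<close>

definition consistent :: "(edge \<times> bool) list \<Rightarrow> edge list \<Rightarrow> nat list list \<Rightarrow> bool" where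
  "consistent fs es U \<longleftrightarrow> split_ok es U (stable_facts fs es U) [] es [] []"

definition greedy :: "edge list \<Rightarrow> nat list list \<Rightarrow> (edge \<times> bool) list" where
  "greedy es U = foldl (\<lambda>fs e. (e, consistent ((e, True) # fs) es U) # fs) [] es"

definition forced_color :: "(edge \<times> bool) list \<Rightarrow> nat \<Rightarrow> nat" where
  "forced_color fs v = length (filter (\<lambda>q. snd q \<and> inc v (fst q)) fs)"

definition edges :: "bool list list \<Rightarrow> edge list" where
  "edges A = concat (map (\<lambda>p. map (\<lambda>q. (fst p, fst q))
     (filter (\<lambda>q. snd q \<and> fst p < fst q) (zip [0..<length A] (snd p)))) (zip [0..<length A] A))"

definition matrix :: "(edge \<times> bool) list \<Rightarrow> nat \<Rightarrow> bool list list" where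
  "matrix fs n = map (\<lambda>i. map (\<lambda>j. \<exists>q\<in>set fs. snd q \<and> (fst q = (i, j) \<or> fst q = (j, i))) [0..<n]) [0..<n]"

text \<open>The outer option tells whether this round decides, the inner one is the answer. Under
  \<open>enc\<close> the inner option already has the required output format: \<open>Null\<close>
  for no, and \<open>Null\<close> paired with the matrix for yes.\<close>

definition attempt :: "bool list list \<Rightarrow> nat list list \<Rightarrow> bool list list option option" where
  "attempt A U =
     (if \<not> consistent [] (edges A) U then Some None
      else if \<forall>e\<in>set (edges A). forced_color (greedy (edges A) U) (fst e) \<noteq> forced_color (greedy (edges A) U) (snd e)
      then Some (Some (matrix (greedy (edges A) U) (length A))) else None)"

definition extend :: "nat \<Rightarrow> nat list list \<Rightarrow> nat list list" where
  "extend N U = concat (map (\<lambda>X. map (\<lambda>v. v # X) [0..<N]) U)"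

text \<open>Exceeds all vertices, the number \<open>n\<close> that pads tuples, and all colors,
  which are at most the number of edges.\<close>

definition base :: "bool list list \<Rightarrow> nat" where
  "base A = length A + length (edges A) + 1"

type_synonym state = "(bool list list \<times> nat list list) \<times> bool list list option option"

definition next_state :: "state \<Rightarrow> state" where
  "next_state z = ((fst (fst z), extend (base (fst (fst z))) (snd (fst z))),
     attempt (fst (fst z)) (extend (base (fst (fst z))) (snd (fst z))))"

section \<open>The algorithm runs in polynomial time per round\<close>

lemma polytime_inc [polytime_rules]:
  assumes "polytime a" "polytime b" shows "polytime (\<lambda>x. inc (a x) (b x))"
  by (rule polytime_comp2[OF _ assms]) (unfold inc_def, intro polytime_rules)

lemma polytime_share [polytime_rules]:
  assumes "polytime a" "polytime b" "polytime c" shows "polytime (\<lambda>x. share (a x) (b x) (c x))"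
  by (rule polytime_comp3[OF _ assms]) (unfold share_def, intro polytime_rules)

text \<open>Merging classes enlarges the data at most by a constant, which gives the additive growth
  that the fold in \<open>split\<close> requires.\<close>

lemma sz_concat_filter: "sz (concat (filter P ps)) + sz (filter (\<lambda>p. \<not> P p) ps) \<le> sz ps + 2"
proof (induction ps)
  case (Cons p ps)
  then show ?case using sz_append[of p "concat (filter P ps)"] sz_ge[of p] by auto
qed simp

lemma polytime_split [polytime_rules]:
  assumes "polytime a" "polytime b" shows "polytime (\<lambda>x. split (a x) (b x))"
proof (rule polytime_comp2[OF _ assms])
  show "polytime (\<lambda>p. split (fst p) (snd p))"
    unfolding split_def
  proof (rule polytime_foldl'[where g = "\<lambda>p. sz p + 10"])
    show "sz (split_step (fst x) a y) \<le> sz a + (sz (x, y) + 10)" for x :: "nat list \<times> edge list" and a y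
      using sz_concat_filter[of "\<lambda>p. \<exists>e'\<in>set p. share (fst x) y e'" a]
      by (simp add: split_step_def)
  qed (auto simp: split_step_def intro!: polytime_rules)
qed

lemma polytime_pieces [polytime_rules]:
  assumes "polytime a" "polytime b" "polytime c" shows "polytime (\<lambda>x. pieces (a x) (b x) (c x))"
  by (rule polytime_comp3[OF _ assms]) (unfold pieces_def, intro polytime_rules)

lemma polytime_lookup [polytime_rules]:
  assumes "polytime a" "polytime b" "polytime c" shows "polytime (\<lambda>x. lookup (a x) (b x) (c x))"
  by (rule polytime_comp3[OF _ assms]) (unfold lookup_def, intro polytime_rules)

lemma polytime_allowed [polytime_rules]:
  assumes "polytime a" "polytime b" "polytime c" shows "polytime (\<lambda>x. allowed (a x) (b x) (c x))"
  by (rule polytime_comp3[OF _ assms]) (unfold allowed_def, intro polytime_rules)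

lemma sz_filter: "sz (filter P xs) \<le> sz xs"
  by (induction xs) auto

text \<open>Every step returns a sublist of \<open>U\<close>, whatever the accumulator is.\<close>

lemma polytime_sums [polytime_rules]:
  assumes "polytime a" "polytime b" "polytime c" "polytime d" "polytime e" shows "polytime (\<lambda>x. sums (a x) (b x) (c x) (d x) (e x))"
proof (rule polytime_comp5[OF _ assms], unfold sums_def, rule polytime_foldl'[where g = sz])
  show "sz (sum_step (fst x) (fst (snd x)) (fst (snd (snd x))) (fst (snd (snd (snd x)))) A y) \<le> sz A + sz (x, y)"
    for x :: "nat list list \<times> fact list \<times> nat list \<times> nat list \<times> edge list list" and A y
    unfolding sum_step_def by (rule order_trans[OF sz_filter]) (cases x, simp)
qed (auto simp: sum_step_def intro!: polytime_rules)

lemma polytime_covered_ok [polytime_rules]: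
  assumes "polytime a" "polytime b" "polytime c" "polytime d" "polytime e" shows "polytime (\<lambda>x. covered_ok (a x) (b x) (c x) (d x) (e x))"
  by (rule polytime_comp5[OF _ assms]) (unfold covered_ok_def, intro polytime_rules)

lemma polytime_split_ok [polytime_rules]:
  assumes "polytime a" "polytime b" "polytime c" "polytime d" "polytime e" "polytime g" "polytime h"
  shows "polytime (\<lambda>x. split_ok (a x) (b x) (c x) (d x) (e x) (g x) (h x))"
  by (rule polytime_comp7[OF _ assms]) (unfold split_ok_def, intro polytime_rules)

lemma polytime_fact_ok [polytime_rules]:
  assumes "polytime a" "polytime b" "polytime c" "polytime d" "polytime e" shows "polytime (\<lambda>x. fact_ok (a x) (b x) (c x) (d x) (e x))"
  by (rule polytime_comp5[OF _ assms]) (unfold fact_ok_def, intro polytime_rules)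

lemma polytime_all_facts [polytime_rules]:
  assumes "polytime a" "polytime b" shows "polytime (\<lambda>x. all_facts (a x) (b x))"
  by (rule polytime_comp2[OF _ assms]) (unfold all_facts_def, intro polytime_rules)

lemma polytime_stable_facts [polytime_rules]:
  assumes "polytime a" "polytime b" "polytime c" shows "polytime (\<lambda>x. stable_facts (a x) (b x) (c x))"
proof (rule polytime_comp3[OF _ assms], unfold stable_facts_def, rule polytime_foldl'[where g = "\<lambda>_. 0"])
  show "sz (filter (fact_ok (fst x) (fst (snd x)) (snd (snd x)) T) T) \<le> sz T + 0"
    for x :: "(edge \<times> bool) list \<times> edge list \<times> nat list list" and T
    by (simp add: sz_filter)
qed (auto intro!: polytime_rules)

lemma polytime_consistent [polytime_rules]:
  assumes "polytime a" "polytime b" "polytime c" shows "polytime (\<lambda>x. consistent (a x) (b x) (c x))"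
  by (rule polytime_comp3[OF _ assms]) (unfold consistent_def, intro polytime_rules)

lemma polytime_greedy [polytime_rules]:
  assumes "polytime a" "polytime b" shows "polytime (\<lambda>x. greedy (a x) (b x))"
proof (rule polytime_comp2[OF _ assms], unfold greedy_def, rule polytime_foldl'[where g = "\<lambda>p. sz p + 10"])
  show "sz ((e, consistent ((e, True) # fs) (fst x) (snd x)) # fs) \<le> sz fs + (sz (x, e) + 10)"
    for x :: "edge list \<times> nat list list" and fs e
    using sz_bool_le[of "consistent ((e, True) # fs) (fst x) (snd x)"] by simp
qed (auto intro!: polytime_rules)

lemma polytime_forced_color [polytime_rules]:
  assumes "polytime a" "polytime b" shows "polytime (\<lambda>x. forced_color (a x) (b x))"
  by (rule polytime_comp2[OF _ assms]) (unfold forced_color_def, intro polytime_rules)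

lemma polytime_edges [polytime_rules]:
  assumes "polytime a" shows "polytime (\<lambda>x. edges (a x))"
  by (rule polytime_comp[OF _ assms]) (unfold edges_def, intro polytime_rules)

lemma polytime_matrix [polytime_rules]:
  assumes "polytime a" "polytime b" shows "polytime (\<lambda>x. matrix (a x) (b x))"
  by (rule polytime_comp2[OF _ assms]) (unfold matrix_def, intro polytime_rules)

lemma polytime_attempt [polytime_rules]:
  assumes "polytime a" "polytime b" shows "polytime (\<lambda>x. attempt (a x) (b x))"
  by (rule polytime_comp2[OF _ assms]) (unfold attempt_def, intro polytime_rules)

lemma polytime_extend [polytime_rules]:
  assumes "polytime a" "polytime b" shows "polytime (\<lambda>x. extend (a x) (b x))"
  by (rule polytime_comp2[OF _ assms]) (unfold extend_def, intro polytime_rules)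

lemma polytime_base [polytime_rules]:
  assumes "polytime a" shows "polytime (\<lambda>x. base (a x))"
  by (rule polytime_comp[OF _ assms]) (unfold base_def, intro polytime_rules)

lemma polytime_next_state: "polytime next_state"
  unfolding next_state_def[abs_def] by (intro polytime_rules)

section \<open>Edge classes\<close>

lemma share_iff: "share Y e e' \<longleftrightarrow> (\<exists>v. v \<notin> set Y \<and> inc v e \<and> inc v e')"
  by (auto simp: share_def inc_def)

text \<open>Connectivity as an induction principle. In this form \<open>connD\<close> carries a
  property from one edge to its whole class without any mention of paths.\<close>

definition conn :: "nat list \<Rightarrow> edge list \<Rightarrow> bool" where
  "conn Y p \<longleftrightarrow> (\<forall>A. (\<exists>e\<in>set p. e \<in> A) \<longrightarrow>
     (\<forall>e\<in>set p. \<forall>e'\<in>set p. e \<in> A \<longrightarrow> share Y e e' \<longrightarrow> e' \<in> A) \<longrightarrow> set p \<subseteq> A)"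

lemma connD:
  assumes "conn Y p" "e \<in> set p" "e \<in> A"
    "\<And>e e'. e \<in> set p \<Longrightarrow> e' \<in> set p \<Longrightarrow> e \<in> A \<Longrightarrow> share Y e e' \<Longrightarrow> e' \<in> A"
  shows "set p \<subseteq> A"
  using assms unfolding conn_def by blast

text \<open>The loop invariant of \<open>split\<close>, where \<open>E\<close> is the set of edges
  inserted so far. Distinctness of the concatenation expresses that the classes are
  disjoint.\<close>

definition classes :: "nat list \<Rightarrow> edge set \<Rightarrow> edge list list \<Rightarrow> bool" where
  "classes Y E ps \<longleftrightarrow> distinct (concat ps) \<and> set (concat ps) = E \<and> (\<forall>p\<in>set ps. p \<noteq> [] \<and> conn Y p) \<and>
     (\<forall>p\<in>set ps. \<forall>q\<in>set ps. \<forall>e\<in>set p. \<forall>e'\<in>set q. share Y e e' \<longrightarrow> p = q)"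

lemma distinct_concat_filter:
  "distinct (concat ps) \<Longrightarrow> distinct (concat (filter P ps) @ concat (filter (\<lambda>p. \<not> P p) ps))"
  by (induction ps) auto

lemma classes_step:
  assumes "classes Y E ps" "e \<notin> E"
  shows "classes Y (insert e E) (split_step Y ps e)"
proof -
  let ?P = "\<lambda>p. \<exists>e'\<in>set p. share Y e e'"
  let ?q = "e # concat (filter ?P ps)"
  let ?rs = "filter (\<lambda>p. \<not> ?P p) ps"
  have d: "distinct (concat ps)" and u: "set (concat ps) = E"
    and c: "\<And>p. p \<in> set ps \<Longrightarrow> p \<noteq> []" "\<And>p. p \<in> set ps \<Longrightarrow> conn Y p"
    and s: "\<And>p q e e'. p \<in> set ps \<Longrightarrow> q \<in> set ps \<Longrightarrow> e \<in> set p \<Longrightarrow> e' \<in> set q \<Longrightarrow> share Y e e' \<Longrightarrow> p = q"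
    using assms(1) unfolding classes_def by blast+
  have conn: "conn Y ?q"
    unfolding conn_def
  proof (intro allI impI)
    fix A
    assume ne: "\<exists>e'\<in>set ?q. e' \<in> A"
      and cl: "\<forall>e1\<in>set ?q. \<forall>e2\<in>set ?q. e1 \<in> A \<longrightarrow> share Y e1 e2 \<longrightarrow> e2 \<in> A"
    have pq: "set p \<subseteq> set ?q" if "p \<in> set ps" "?P p" for p
      using that by auto
    have sub: "set p \<subseteq> A" if "p \<in> set ps" "?P p" "e1 \<in> set p" "e1 \<in> A" for p e1
    proof (rule connD[OF c(2)[OF that(1)] that(3,4)])
      fix e1 e2 assume "e1 \<in> set p" "e2 \<in> set p" "e1 \<in> A" "share Y e1 e2"
      then show "e2 \<in> A" using cl pq[OF that(1,2)] by blast
    qed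
    \<comment> \<open>If \<open>A\<close> meets a merged class, it contains the class, in particular
      the edge of it that shares a vertex with \<open>e\<close>. So \<open>e\<close> is reached from
      everywhere, and all merged classes are reached from \<open>e\<close>.\<close>
    have "e \<in> A"
    proof -
      from ne obtain e1 where e1: "e1 \<in> set ?q" "e1 \<in> A" by blast
      show ?thesis
      proof (cases "e1 = e")
        case False
        then obtain p where p: "p \<in> set ps" "?P p" "e1 \<in> set p" using e1 by auto
        then obtain e' where e': "e' \<in> set p" "share Y e e'" by blast
        have "e' \<in> A" using sub[OF p e1(2)] e' by blast
        moreover have "share Y e' e" using e' by (auto simp: share_iff)
        moreover have "e' \<in> set ?q" using pq[OF p(1,2)] e' by blast
        ultimately show ?thesis using cl by (meson list.set_intros(1))
      qed (use e1 in simp)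
    qed
    moreover have "set p \<subseteq> A" if p: "p \<in> set ps" "?P p" for p
    proof -
      obtain e' where e': "e' \<in> set p" "share Y e e'" using p by blast
      then have "e' \<in> set ?q" using pq[OF p] by blast
      then have "e' \<in> A" using cl \<open>e \<in> A\<close> e' by (meson list.set_intros(1))
      then show ?thesis using sub p e' by blast
    qed
    ultimately show "set ?q \<subseteq> A" by auto
  qed
  \<comment> \<open>The remaining classes avoid \<open>e\<close> by the filter and the merged
    classes by the old invariant.\<close>
  have sep: "\<not> share Y e1 e2" if h: "e1 \<in> set ?q" "p \<in> set ?rs" "e2 \<in> set p" for e1 e2 p
  proof (cases "e1 = e")
    case True
    then show ?thesis using h by auto
  next
    case False
    then obtain p' where p': "p' \<in> set ps" "?P p'" "e1 \<in> set p'" using h by auto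
    have p: "p \<in> set ps" "\<not> ?P p" using h by auto
    then have "p' \<noteq> p" using p' by blast
    then show ?thesis using s[OF p'(1) p(1) p'(3) h(3)] by blast
  qed
  show ?thesis
    unfolding classes_def split_step_def
  proof (intro conjI ballI impI)
    have "e \<notin> set (concat ps)" using assms(2) u by simp
    then show "distinct (concat (?q # ?rs))"
      using distinct_concat_filter[OF d, of ?P] by auto
    have "set (concat (filter P ps)) \<union> set (concat (filter (\<lambda>p. \<not> P p) ps)) = set (concat ps)" for P
      by (induction ps) auto
    from this[of ?P] show "set (concat (?q # ?rs)) = insert e E"
      unfolding u [symmetric] by (simp add: Un_assoc)
  next
    fix p assume "p \<in> set (?q # ?rs)"
    then show "p \<noteq> []" "conn Y p" using c conn by auto
  next
    fix p q e1 e2 assume a: "p \<in> set (?q # ?rs)" "q \<in> set (?q # ?rs)" "e1 \<in> set p" "e2 \<in> set q" "share Y e1 e2"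
    have b: "share Y e2 e1" using a(5) by (auto simp: share_iff)
    consider "p = ?q" "q = ?q" | "p = ?q" "q \<in> set ?rs" | "p \<in> set ?rs" "q = ?q"
      | "p \<in> set ?rs" "q \<in> set ?rs"
      using a(1,2) unfolding list.set(2) by blast
    then show "p = q"
    proof cases
      case 2
      then show ?thesis using sep[of e1 q e2] a by blast
    next
      case 3
      then show ?thesis using sep[of e2 p e1] a b by blast
    next
      case 4
      then have "p \<in> set ps" "q \<in> set ps" by simp_all
      then show ?thesis using s a by blast
    qed simp
  qed
qed

lemma classes_split: "distinct es \<Longrightarrow> classes Y (set es) (split Y es)"
proof (induction es rule: rev_induct)
  case Nil
  show ?case by (simp add: classes_def split_def)
next
  case (snoc e es)
  then have "classes Y (insert e (set es)) (split_step Y (split Y es) e)" by (intro classes_step) auto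
  then show ?case by (simp add: split_def)
qed

context
  fixes Y :: "nat list" and es :: "edge list"
  assumes dist: "distinct es"
begin

lemma split_subset: "p \<in> set (split Y es) \<Longrightarrow> set p \<subseteq> set es"
  using classes_split[OF dist, of Y] by (auto simp: classes_def)

lemma split_cover: "e \<in> set es \<Longrightarrow> \<exists>p\<in>set (split Y es). e \<in> set p"
  using classes_split[OF dist, of Y] by (auto simp: classes_def)

lemma split_conn: "p \<in> set (split Y es) \<Longrightarrow> conn Y p"
  using classes_split[OF dist, of Y] by (auto simp: classes_def)

lemma split_nonempty: "p \<in> set (split Y es) \<Longrightarrow> p \<noteq> []"
  using classes_split[OF dist, of Y] by (auto simp: classes_def)

lemma split_share:
  "p \<in> set (split Y es) \<Longrightarrow> q \<in> set (split Y es) \<Longrightarrow> e \<in> set p \<Longrightarrow> e' \<in> set q \<Longrightarrow> share Y e e' \<Longrightarrow> p = q"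
  using classes_split[OF dist, of Y] unfolding classes_def by blast

lemma split_distinct: "distinct (split Y es)"
proof -
  have "distinct (concat ps) \<Longrightarrow> \<forall>p\<in>set ps. p \<noteq> [] \<Longrightarrow> distinct ps" for ps :: "edge list list"
  proof (induction ps)
    case (Cons p ps)
    then have "set p \<inter> \<Union> (set ` set ps) = {}" "p \<noteq> []" by auto
    then have "p \<notin> set ps" by (cases p) auto
    with Cons show ?case by auto
  qed simp
  then show ?thesis using classes_split[OF dist, of Y] by (auto simp: classes_def)
qed

lemma split_disjoint:
  assumes "p \<in> set (split Y es)" "q \<in> set (split Y es)" "e \<in> set p" "e \<in> set q"
  shows "p = q"
proof -
  have "distinct (concat ps) \<Longrightarrow> p \<in> set ps \<Longrightarrow> q \<in> set ps \<Longrightarrow> p = q" for ps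
    using assms(3,4) by (induction ps) auto
  then show ?thesis using classes_split[OF dist, of Y] assms by (auto simp: classes_def)
qed

end

text \<open>Says that \<open>X\<close> separates \<open>D\<close> from the remaining edges;
  \<open>split\<close> delivers such sets.\<close>

definition closed_in :: "edge set \<Rightarrow> nat set \<Rightarrow> edge set \<Rightarrow> bool" where
  "closed_in E X D \<longleftrightarrow> D \<subseteq> E \<and> (\<forall>e\<in>D. \<forall>e'\<in>E. \<forall>v. v \<notin> X \<and> inc v e \<and> inc v e' \<longrightarrow> e' \<in> D)"

lemma closed_in_split:
  assumes "distinct es" "p \<in> set (split Y es)"
  shows "closed_in (set es) (set Y) (set p)"
  unfolding closed_in_def
proof (intro conjI ballI allI impI)
  show "set p \<subseteq> set es" using assms by (rule split_subset)
next
  fix e e' v assume a: "e \<in> set p" "e' \<in> set es" "v \<notin> set Y \<and> inc v e \<and> inc v e'"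
  obtain q where "q \<in> set (split Y es)" "e' \<in> set q" using split_cover[OF assms(1) a(2)] by blast
  then show "e' \<in> set p" using split_share[OF assms(1,2) _ a(1), of q e'] a(3) by (auto simp: share_iff)
qed

text \<open>A vertex of \<open>D\<close> outside \<open>Y\<close> cannot lie in \<open>X\<close>,
  since \<open>Y\<close> takes over the part of \<open>X\<close> that touches
  \<open>D\<close>.\<close>

lemma closed_in_mono:
  assumes "closed_in E X D" "\<And>x e. x \<in> X \<Longrightarrow> e \<in> D \<Longrightarrow> inc x e \<Longrightarrow> x \<in> Y"
  shows "closed_in E Y D"
  using assms unfolding closed_in_def by blast

text \<open>A class is connected outside \<open>Y\<close> and \<open>D\<close> is closed there, so a
  class with one edge in \<open>D\<close> lies entirely in \<open>D\<close>.\<close>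

lemma pieces_Union:
  assumes "distinct es" "closed_in (set es) (set Y) (set D)"
  shows "(\<Union>p\<in>set (pieces Y es D). set p) = set D"
proof
  show "set D \<subseteq> (\<Union>p\<in>set (pieces Y es D). set p)"
    using assms(2) split_cover[OF assms(1), of _ Y] unfolding pieces_def closed_in_def by fastforce
  show "(\<Union>p\<in>set (pieces Y es D). set p) \<subseteq> set D"
  proof (rule UN_least)
    fix p assume "p \<in> set (pieces Y es D)"
    then obtain e where p: "p \<in> set (split Y es)" "e \<in> set p" "e \<in> set D"
      by (auto simp: pieces_def)
    show "set p \<subseteq> set D"
      by (rule connD[OF split_conn[OF assms(1) p(1)] p(2,3)])
        (use assms(2) split_subset[OF assms(1) p(1)] in \<open>unfold closed_in_def share_iff, blast\<close>)
  qed
qed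

lemma pieces_split: "p \<in> set (pieces Y es D) \<Longrightarrow> p \<in> set (split Y es)"
  by (simp add: pieces_def)

lemma pieces_distinct: "distinct es \<Longrightarrow> distinct (pieces Y es D)"
  unfolding pieces_def by (intro distinct_filter split_distinct)

section \<open>Contributions of edge sets to vertex colors\<close>

definition wsum :: "(edge \<Rightarrow> bool) \<Rightarrow> edge set \<Rightarrow> nat \<Rightarrow> nat" where
  "wsum w D v = card {e \<in> D. inc v e \<and> w e}"

lemma wsum_le: "wsum w (set D) v \<le> length D"
  unfolding wsum_def by (rule order_trans[OF card_mono card_length[of D]]) auto

lemma wsum_cong: "(\<And>e. e \<in> D \<Longrightarrow> w e = w' e) \<Longrightarrow> wsum w D v = wsum w' D v"
  unfolding wsum_def by (rule arg_cong[where f = card]) auto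

lemma wsum_local:
  assumes "D' \<subseteq> D" "\<And>e. e \<in> D \<Longrightarrow> inc v e \<Longrightarrow> e \<in> D'"
  shows "wsum w D v = wsum w D' v"
  unfolding wsum_def using assms by (intro arg_cong[where f = card]) auto

lemma wsum_zero:
  assumes "\<And>e. e \<in> D \<Longrightarrow> \<not> inc v e" shows "wsum w D v = 0"
proof -
  have "{e \<in> D. inc v e \<and> w e} = {}" using assms by blast
  then show ?thesis by (simp only: wsum_def card.empty)
qed

lemma wsum_pieces:
  assumes "distinct es" "closed_in (set es) (set Y) (set D)"
  shows "wsum w (set D) v = (\<Sum>p\<in>set (pieces Y es D). wsum w (set p) v)"
proof -
  have "{e \<in> set D. inc v e \<and> w e} = (\<Union>p\<in>set (pieces Y es D). {e \<in> set p. inc v e \<and> w e})"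
    using pieces_Union[OF assms] by auto
  also have "card \<dots> = (\<Sum>p\<in>set (pieces Y es D). card {e \<in> set p. inc v e \<and> w e})"
  proof (rule card_UN_disjoint)
    show "\<forall>p\<in>set (pieces Y es D). \<forall>q\<in>set (pieces Y es D). p \<noteq> q \<longrightarrow>
        {e \<in> set p. inc v e \<and> w e} \<inter> {e \<in> set q. inc v e \<and> w e} = {}"
      using split_disjoint[OF assms(1)] pieces_split by blast
  qed auto
  finally show ?thesis by (simp add: wsum_def)
qed

section \<open>Soundness and completeness of the facts\<close>

text \<open>All occurrences of \<open>x\<close> in \<open>X\<close> carry the same value, so it does
  not matter which one is found.\<close>

lemma lookup_map:
  assumes "x \<in> set X" shows "lookup X (map f X) x = f x"
proof -
  have z: "zip X (map f X) = map (\<lambda>x. (x, f x)) X" by (induction X) auto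
  let ?l = "filter (\<lambda>p. fst p = x) (map (\<lambda>x. (x, f x)) X)"
  have "(x, f x) \<in> set ?l" using assms by auto
  moreover have "snd q = f x" if "q \<in> set ?l" for q using that by auto
  ultimately show ?thesis unfolding lookup_def z by (cases ?l) auto
qed

text \<open>\<open>\<gamma>\<close> guesses the final colors. When \<open>X\<close> separates
  \<open>D\<close>, all edges at a vertex of \<open>D\<close> outside \<open>X\<close> lie in
  \<open>D\<close>, so \<open>D\<close> must realise the guess there; at \<open>X\<close> other
  classes may contribute as well.\<close>

definition solves :: "(edge \<times> bool) list \<Rightarrow> nat set \<Rightarrow> edge set \<Rightarrow> (nat \<Rightarrow> nat) \<Rightarrow> (edge \<Rightarrow> bool) \<Rightarrow> bool" where
  "solves fs X D \<gamma> w \<longleftrightarrow> (\<forall>e\<in>D. allowed fs e (w e) \<and> \<gamma> (fst e) \<noteq> \<gamma> (snd e)) \<and>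
     (\<forall>v. v \<notin> X \<and> (\<exists>e\<in>D. inc v e) \<longrightarrow> wsum w D v = \<gamma> v)"

definition feasible :: "(edge \<times> bool) list \<Rightarrow> nat set \<Rightarrow> edge set \<Rightarrow> (nat \<Rightarrow> nat) \<Rightarrow> (nat \<Rightarrow> nat) \<Rightarrow> bool" where
  "feasible fs X D c s \<longleftrightarrow> (\<exists>\<gamma> w. solves fs X D \<gamma> w \<and> (\<forall>x\<in>X. \<gamma> x = c x \<and> wsum w D x = s x))"

definition feasible_fact :: "(edge \<times> bool) list \<Rightarrow> fact \<Rightarrow> bool" where
  "feasible_fact fs f \<longleftrightarrow> feasible fs (set (fst (fst f))) (set (snd (fst f)))
     (lookup (fst (fst f)) (fst (snd f))) (lookup (fst (fst f)) (snd (snd f)))"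

definition tuples :: "nat \<Rightarrow> nat \<Rightarrow> nat list set" where
  "tuples N K = {xs. length xs = K \<and> set xs \<subseteq> {..<N}}"

lemma map_tuples: "Y \<in> tuples N K \<Longrightarrow> (\<And>y. y \<in> set Y \<Longrightarrow> f y < N) \<Longrightarrow> map f Y \<in> tuples N K"
  by (auto simp: tuples_def)

lemma lookup_bound:
  assumes "c \<in> tuples N K" "0 < N" shows "lookup X c x < N"
proof (cases "filter (\<lambda>p. fst p = x) (zip X c)")
  case (Cons p ps)
  then have "p \<in> set (filter (\<lambda>p. fst p = x) (zip X c))" by simp
  then have "p \<in> set (zip X c)" by simp
  then have "snd p \<in> set c" by (metis prod.collapse set_zip_rightD)
  then show ?thesis using Cons assms by (auto simp: lookup_def tuples_def)
qed (use assms in \<open>simp add: lookup_def\<close>)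

text \<open>Partial sums are at most the total and hence below \<open>N\<close>. This keeps the
  intermediate tuples in \<open>U\<close>, from which \<open>sum_step\<close> draws them.\<close>

lemma sums_sound:
  assumes "distinct ps" "set U = tuples N K" "Y \<in> tuples N K"
    and "\<And>p. p \<in> set ps \<Longrightarrow> ((Y, p), c, map (\<sigma> p) Y) \<in> set T"
    and "\<And>y. y \<in> set Y \<Longrightarrow> (\<Sum>p\<in>set ps. \<sigma> p y) < N"
  shows "map (\<lambda>y. \<Sum>p\<in>set ps. \<sigma> p y) Y \<in> set (sums U T Y c ps)"
  using assms(1,4,5)
proof (induction ps rule: rev_induct)
  case Nil
  then show ?case using map_tuples[OF assms(3), of "\<lambda>_. 0"] assms(2) by (auto simp: sums_def lookup_map)
next
  case (snoc p ps)
  have sm: "(\<Sum>q\<in>set (ps @ [p]). \<sigma> q y) = (\<Sum>q\<in>set ps. \<sigma> q y) + \<sigma> p y" for y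
    using snoc.prems(1) by (simp add: add.commute)
  have lt: "(\<Sum>q\<in>set ps. \<sigma> q y) + \<sigma> p y < N" if "y \<in> set Y" for y
    using snoc.prems(3)[OF that] unfolding sm .
  let ?a = "map (\<lambda>y. \<Sum>q\<in>set ps. \<sigma> q y) Y"
  have "?a \<in> set (sums U T Y c ps)"
    using snoc.prems lt by (intro snoc.IH) (auto intro: add_lessD1)
  moreover have "map (\<sigma> p) Y \<in> set U"
    unfolding assms(2) using assms(3) lt by (intro map_tuples) (auto dest: add_lessD1 simp: add.commute)
  moreover have "map (\<lambda>y. (\<Sum>q\<in>set ps. \<sigma> q y) + \<sigma> p y) Y \<in> set U"
    unfolding assms(2) using assms(3) lt by (intro map_tuples) auto
  moreover have "((Y, p), c, map (\<sigma> p) Y) \<in> set T" using snoc.prems by simp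
  ultimately have "map (\<lambda>y. (\<Sum>q\<in>set ps. \<sigma> q y) + \<sigma> p y) Y \<in> set (sum_step U T Y c (sums U T Y c ps) p)"
    unfolding sum_step_def set_filter
    by (intro CollectI conjI bexI[of _ ?a] bexI[of _ "map (\<sigma> p) Y"]) (auto simp: lookup_map)
  then show ?case unfolding sm by (simp add: sums_def)
qed

lemma sums_complete:
  assumes "distinct ps" "u \<in> set (sums U T Y c ps)"
  shows "\<exists>\<sigma>. (\<forall>p\<in>set ps. ((Y, p), c, \<sigma> p) \<in> set T) \<and>
     (\<forall>y\<in>set Y. lookup Y u y = (\<Sum>p\<in>set ps. lookup Y (\<sigma> p) y))"
  using assms
proof (induction ps arbitrary: u rule: rev_induct)
  case Nil
  then show ?case by (auto simp: sums_def)
next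
  case (snoc p ps)
  then have "u \<in> set (sum_step U T Y c (sums U T Y c ps) p)" by (simp add: sums_def)
  then obtain a s where a: "a \<in> set (sums U T Y c ps)" "((Y, p), c, s) \<in> set T"
      "\<forall>y\<in>set Y. lookup Y u y = lookup Y a y + lookup Y s y"
    by (auto simp: sum_step_def)
  obtain \<sigma> where \<sigma>: "\<forall>q\<in>set ps. ((Y, q), c, \<sigma> q) \<in> set T"
      "\<forall>y\<in>set Y. lookup Y a y = (\<Sum>q\<in>set ps. lookup Y (\<sigma> q) y)"
    using snoc.IH[OF _ a(1)] snoc.prems(1) by auto
  have p: "p \<notin> set ps" using snoc.prems(1) by simp
  then have "(\<Sum>q\<in>set ps. lookup Y ((\<sigma>(p := s)) q) y) = (\<Sum>q\<in>set ps. lookup Y (\<sigma> q) y)" for y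
    by (intro sum.cong) auto
  then show ?case
    using a \<sigma> p by (intro exI[of _ "\<sigma>(p := s)"]) (auto simp: add.commute)
qed

text \<open>A solution on \<open>D\<close> is restricted to \<open>Y\<close>: its colors give
  \<open>c'\<close>, its contributions on the pieces give feasible facts, which are in
  \<open>T\<close> by assumption, and the total of these is \<open>u\<close>.\<close>

lemma split_ok_sound:
  assumes dist: "distinct es" and U: "set U = tuples N K" and N: "length es < N"
    and cl: "closed_in (set es) (set X) (set D)"
    and feas: "feasible fs (set X) (set D) (lookup X c) (lookup X s)"
    and cN: "\<And>x. x \<in> set X \<Longrightarrow> lookup X c x < N"
    and T: "\<And>f. f \<in> set (all_facts es U) \<Longrightarrow> feasible_fact fs f \<Longrightarrow> f \<in> set T"
  shows "split_ok es U T X D c s"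
  unfolding split_ok_def
proof (intro ballI impI)
  fix Y assume Y: "Y \<in> set U" and XY: "\<forall>x\<in>set X. (\<exists>e\<in>set D. inc x e) \<longrightarrow> x \<in> set Y"
  from feas obtain \<gamma> w where sol: "solves fs (set X) (set D) \<gamma> w"
    and \<gamma>X: "\<And>x. x \<in> set X \<Longrightarrow> \<gamma> x = lookup X c x" and wX: "\<And>x. x \<in> set X \<Longrightarrow> wsum w (set D) x = lookup X s x"
    unfolding feasible_def by blast
  have clY: "closed_in (set es) (set Y) (set D)"
    using cl by (rule closed_in_mono) (use XY in blast)
  have D_le: "wsum w (set D) v < N" for v
  proof -
    have "wsum w (set D) v \<le> wsum w (set es) v"
      unfolding wsum_def using cl by (intro card_mono) (auto simp: closed_in_def)
    also have "\<dots> \<le> length es" by (rule wsum_le)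
    finally show ?thesis using N by simp
  qed
  \<comment> \<open>\<open>\<gamma>\<close> is arbitrary at vertices that neither lie in
    \<open>X\<close> nor touch \<open>D\<close>. It is reset to 0 there, so that the colors on
    \<open>Y\<close> stay below \<open>N\<close> and form a tuple of \<open>U\<close>.\<close>
  define \<gamma>' where "\<gamma>' v = (if v \<in> set X \<or> (\<exists>e\<in>set D. inc v e) then \<gamma> v else 0)" for v
  have \<gamma>'D: "\<gamma>' v = \<gamma> v" if "e \<in> set D" "inc v e" for v e
    using that by (auto simp: \<gamma>'_def)
  have \<gamma>D: "wsum w (set D) v = \<gamma> v" if "v \<notin> set X" "e \<in> set D" "inc v e" for v e
    using sol that unfolding solves_def by blast
  have \<gamma>N: "\<gamma>' v < N" for v
  proof (cases "v \<in> set X")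
    case False
    show ?thesis
    proof (cases "\<exists>e\<in>set D. inc v e")
      case True
      then show ?thesis using \<gamma>D[OF False] D_le[of v] by (auto simp: \<gamma>'_def)
    qed (use False N in \<open>simp add: \<gamma>'_def\<close>)
  qed (use cN \<gamma>X in \<open>simp add: \<gamma>'_def\<close>)
  define ps where "ps = pieces Y es D"
  have ps: "\<And>p. p \<in> set ps \<Longrightarrow> p \<in> set (split Y es)" "(\<Union>p\<in>set ps. set p) = set D" "distinct ps"
    unfolding ps_def using pieces_split pieces_Union[OF dist clY] pieces_distinct[OF dist] by blast+
  have sumD: "(\<Sum>p\<in>set ps. wsum w (set p) y) = wsum w (set D) y" for y
    unfolding ps_def by (rule wsum_pieces[OF dist clY, symmetric])
  define c' where "c' = map \<gamma>' Y"
  define u where "u = map (\<lambda>y. \<Sum>p\<in>set ps. wsum w (set p) y) Y"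
  have Y': "Y \<in> tuples N K" using Y U by simp
  have c'U: "c' \<in> set U" unfolding c'_def U by (rule map_tuples[OF Y' \<gamma>N])
  have fact: "((Y, p), c', map (wsum w (set p)) Y) \<in> set T" if p: "p \<in> set ps" for p
  proof (rule T)
    have pD: "set p \<subseteq> set D" using ps(2) p by blast
    have "wsum w (set p) y < N" for y
    proof -
      have "wsum w (set p) y \<le> wsum w (set D) y"
        unfolding wsum_def using pD by (intro card_mono) auto
      with D_le[of y] show ?thesis by simp
    qed
    then have "map (wsum w (set p)) Y \<in> set U" unfolding U using Y' by (intro map_tuples)
    then show "((Y, p), c', map (wsum w (set p)) Y) \<in> set (all_facts es U)"
      using Y c'U ps(1)[OF p] by (auto simp: all_facts_def)
    have "solves fs (set Y) (set p) \<gamma>' w"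
      unfolding solves_def
    proof (intro conjI ballI allI impI)
      fix e assume "e \<in> set p"
      then have e: "e \<in> set D" using pD by blast
      then show "allowed fs e (w e)" using sol by (simp add: solves_def)
      have "\<gamma> (fst e) \<noteq> \<gamma> (snd e)" using sol e by (simp add: solves_def)
      then show "\<gamma>' (fst e) \<noteq> \<gamma>' (snd e)" using \<gamma>'D[OF e] by (simp add: inc_def)
    next
      fix v assume "v \<notin> set Y \<and> (\<exists>e\<in>set p. inc v e)"
      then obtain e where v: "v \<notin> set Y" "e \<in> set p" "inc v e" by blast
      then have e: "e \<in> set D" using pD by blast
      have "v \<notin> set X" using XY v e by blast
      \<comment> \<open>All edges of \<open>D\<close> at a vertex outside \<open>Y\<close> lie in
        one piece, which therefore contributes the whole color.\<close>
      have "wsum w (set D) v = wsum w (set p) v"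
      proof (rule wsum_local[OF pD])
        fix e' assume "e' \<in> set D" "inc v e'"
        then show "e' \<in> set p"
          using closed_in_split[OF dist ps(1)[OF p]] v cl unfolding closed_in_def by blast
      qed
      then show "wsum w (set p) v = \<gamma>' v"
        using \<gamma>D[OF \<open>v \<notin> set X\<close> e v(3)] \<gamma>'D[OF e v(3)] by simp
    qed
    then show "feasible_fact fs ((Y, p), c', map (wsum w (set p)) Y)"
      unfolding feasible_fact_def feasible_def c'_def by (auto simp: lookup_map intro!: exI[of _ \<gamma>'] exI[of _ w])
  qed
  have "u \<in> set (sums U T Y c' ps)"
    unfolding u_def using ps(3) U Y' fact by (rule sums_sound) (simp_all add: sumD D_le)
  moreover have "lookup X s x = (if x \<in> set Y then lookup Y u x else 0)" if "x \<in> set X" for x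
  proof (cases "x \<in> set Y")
    case True
    then show ?thesis using wX[OF that] by (simp add: u_def lookup_map sumD)
  next
    case False
    then have "wsum w (set D) x = 0" using XY that by (intro wsum_zero) blast
    then show ?thesis using wX[OF that] False by simp
  qed
  moreover have "lookup Y u y = lookup Y c' y" if "y \<in> set Y" "y \<notin> set X" "e \<in> set D" "inc y e" for y e
    using that \<gamma>D[OF that(2-4)] \<gamma>'D[OF that(3,4)] by (simp add: u_def c'_def lookup_map sumD)
  moreover have "lookup Y c' x = lookup X c x" if "x \<in> set X" "x \<in> set Y" for x
    using that \<gamma>X by (simp add: c'_def lookup_map \<gamma>'_def)
  ultimately show "\<exists>c'\<in>set U. (\<forall>x\<in>set X. x \<in> set Y \<longrightarrow> lookup Y c' x = lookup X c x) \<and>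
       (\<exists>u\<in>set (sums U T Y c' (pieces Y es D)).
          (\<forall>x\<in>set X. lookup X s x = (if x \<in> set Y then lookup Y u x else 0)) \<and>
          (\<forall>y\<in>set Y. y \<notin> set X \<and> (\<exists>e\<in>set D. inc y e) \<longrightarrow> lookup Y u y = lookup Y c' y))"
    unfolding ps_def using c'U by blast
qed

text \<open>Edges with both ends in \<open>X\<close> share nothing outside \<open>X\<close>, so a
  single edge is already closed under sharing and connectivity leaves no other one.\<close>

lemma covered_single:
  assumes "distinct es" "D \<in> set (split X es)" "\<forall>e\<in>set D. fst e \<in> set X \<and> snd e \<in> set X"
  shows "\<exists>e. set D = {e}"
proof -
  obtain e where e: "e \<in> set D" using split_nonempty[OF assms(1,2)] by (cases D) auto
  have "set D \<subseteq> {e}"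
    by (rule connD[OF split_conn[OF assms(1,2)] e]) (use assms(3) in \<open>auto simp: share_def\<close>)
  with e have "set D = {e}" by blast
  then show ?thesis ..
qed

lemma wsum_single: "wsum w {e} v = (if w e \<and> inc v e then 1 else 0)"
proof -
  have "{e' \<in> {e}. inc v e' \<and> w e'} = (if w e \<and> inc v e then {e} else {})" by auto
  then show ?thesis by (simp add: wsum_def)
qed

lemma covered_ok_iff:
  assumes "distinct es" "D \<in> set (split X es)" "\<forall>e\<in>set D. fst e \<in> set X \<and> snd e \<in> set X"
  shows "covered_ok fs X D c s \<longleftrightarrow> feasible fs (set X) (set D) (lookup X c) (lookup X s)"
proof -
  obtain e where e: "set D = {e}" using covered_single[OF assms] by blast
  with assms(3) have X: "fst e \<in> set X" "snd e \<in> set X" by auto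
  show ?thesis
  proof
    assume "covered_ok fs X D c s"
    then obtain b where "allowed fs e b" "lookup X c (fst e) \<noteq> lookup X c (snd e)"
        "\<forall>x\<in>set X. lookup X s x = (if b \<and> inc x e then 1 else 0)"
      unfolding covered_ok_def e by blast
    then show "feasible fs (set X) (set D) (lookup X c) (lookup X s)"
      unfolding feasible_def solves_def e using X
      by (intro exI[of _ "lookup X c"] exI[of _ "\<lambda>_. b"]) (auto simp: wsum_single inc_def)
  next
    assume "feasible fs (set X) (set D) (lookup X c) (lookup X s)"
    then obtain \<gamma> w where "solves fs (set X) {e} \<gamma> w"
        "\<forall>x\<in>set X. \<gamma> x = lookup X c x \<and> wsum w {e} x = lookup X s x"
      unfolding feasible_def e by blast
    then show "covered_ok fs X D c s"
      unfolding covered_ok_def e solves_def using X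
      by (intro bexI[of _ "w e"]) (auto simp: wsum_single)
  qed
qed

lemma mem_all_facts:
  "((X, D), c, s) \<in> set (all_facts es U) \<longleftrightarrow>
     X \<in> set U \<and> D \<in> set (split X es) \<and> c \<in> set U \<and> s \<in> set U"
  by (auto simp: all_facts_def)

text \<open>That all feasible facts are present is an invariant of the deletion rounds: it is
  exactly what \<open>split_ok_sound\<close> assumes of \<open>T\<close>.\<close>

lemma stable_facts_sound:
  assumes dist: "distinct es" and U: "set U = tuples N K" and N: "length es < N"
    and f: "f \<in> set (all_facts es U)" "feasible_fact fs f"
  shows "f \<in> set (stable_facts fs es U)"
proof -
  have step: "f \<in> set (filter (fact_ok fs es U T) T)"
    if T: "\<And>f. f \<in> set (all_facts es U) \<Longrightarrow> feasible_fact fs f \<Longrightarrow> f \<in> set T"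
      and f: "f \<in> set (all_facts es U)" "feasible_fact fs f" for T f
  proof -
    obtain X D c s where [simp]: "f = ((X, D), c, s)" by (metis prod.collapse)
    have X: "X \<in> set U" "D \<in> set (split X es)" "c \<in> set U"
      using f(1) by (auto simp: mem_all_facts)
    have feas: "feasible fs (set X) (set D) (lookup X c) (lookup X s)"
      using f(2) by (simp add: feasible_fact_def)
    have "split_ok es U T X D c s"
      using dist U N closed_in_split[OF dist X(2)] feas _ T
      by (rule split_ok_sound) (use X U N in \<open>auto intro: lookup_bound\<close>)
    moreover have "covered_ok fs X D c s" if "\<forall>e\<in>set D. fst e \<in> set X \<and> snd e \<in> set X"
      using covered_ok_iff[OF dist X(2) that] feas by simp
    ultimately have "fact_ok fs es U T f" by (simp add: fact_ok_def)
    then show ?thesis using T[OF f] by simp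
  qed
  have "f \<in> set (foldl (\<lambda>T _. filter (fact_ok fs es U T) T) T xs)"
    if "\<And>f. f \<in> set (all_facts es U) \<Longrightarrow> feasible_fact fs f \<Longrightarrow> f \<in> set T" for T and xs :: "fact list"
    using that
  proof (induction xs arbitrary: T)
    case Nil
    then show ?case using f by simp
  next
    case (Cons x xs)
    show ?case unfolding foldl_Cons by (rule Cons.IH) (rule step[OF Cons.prems])
  qed
  then show ?thesis by (simp add: stable_facts_def)
qed

definition solvable :: "(edge \<times> bool) list \<Rightarrow> edge set \<Rightarrow> bool" where
  "solvable fs E \<longleftrightarrow> (\<exists>w. \<forall>e\<in>E. allowed fs e (w e) \<and> wsum w E (fst e) \<noteq> wsum w E (snd e))"

text \<open>With an empty boundary, the guessed color of every end of an edge must equal the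
  contribution of \<open>E\<close>.\<close>

lemma solvable_iff_feasible: "solvable fs E \<longleftrightarrow> feasible fs {} E c s"
proof
  assume "solvable fs E"
  then obtain w where "\<forall>e\<in>E. allowed fs e (w e) \<and> wsum w E (fst e) \<noteq> wsum w E (snd e)"
    unfolding solvable_def by blast
  then show "feasible fs {} E c s"
    unfolding feasible_def solves_def by (intro exI[of _ "wsum w E"] exI[of _ w]) auto
next
  assume "feasible fs {} E c s"
  then obtain \<gamma> w where "\<forall>e\<in>E. allowed fs e (w e) \<and> \<gamma> (fst e) \<noteq> \<gamma> (snd e)"
      "\<forall>v. (\<exists>e\<in>E. inc v e) \<longrightarrow> wsum w E v = \<gamma> v"
    unfolding feasible_def solves_def by auto
  moreover from this(2) have "wsum w E (fst e) = \<gamma> (fst e)" "wsum w E (snd e) = \<gamma> (snd e)" if "e \<in> E" for e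
    using that unfolding inc_def by blast+
  ultimately have "\<forall>e\<in>E. allowed fs e (w e) \<and> wsum w E (fst e) \<noteq> wsum w E (snd e)"
    by simp
  then show "solvable fs E" unfolding solvable_def by blast
qed

lemma consistent_sound:
  assumes "distinct es" "set U = tuples N K" "length es < N" "solvable fs (set es)"
  shows "consistent fs es U"
  unfolding consistent_def
proof (rule split_ok_sound[OF assms(1-3)])
  show "closed_in (set es) (set []) (set es)" by (auto simp: closed_in_def)
  show "feasible fs (set []) (set es) (lookup [] []) (lookup [] [])"
    using assms(4) solvable_iff_feasible by simp
qed (use stable_facts_sound[OF assms(1-3)] in auto)

text \<open>The number of rounds is sufficient because every round that is not the last one deletes a fact.\<close>

lemma stable_facts_fixed: "f \<in> set (stable_facts fs es U) \<Longrightarrow> fact_ok fs es U (stable_facts fs es U) f"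
proof -
  let ?F = "\<lambda>T. filter (fact_ok fs es U T) T"
  have fixed: "foldl (\<lambda>T _. ?F T) T xs = T" if "?F T = T" for T and xs :: "fact list"
    using that by (induction xs) auto
  have "?F (foldl (\<lambda>T _. ?F T) T xs) = foldl (\<lambda>T _. ?F T) T xs" if "length T \<le> length xs" for T and xs :: "fact list"
    using that
  proof (induction xs arbitrary: T)
    case (Cons x xs)
    show ?case
    proof (cases "?F T = T")
      case False
      then have "length (?F T) < length T"
        by (meson filter_id_conv length_filter_less)
      then show ?thesis using Cons by simp
    qed (use fixed[of T "x # xs"] in simp)
  qed simp
  then have "?F (stable_facts fs es U) = stable_facts fs es U" by (simp add: stable_facts_def)
  then show "f \<in> set (stable_facts fs es U) \<Longrightarrow> fact_ok fs es U (stable_facts fs es U) f"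
    unfolding filter_id_conv by blast
qed

lemma stable_facts_subset: "set (stable_facts fs es U) \<subseteq> set (all_facts es U)"
proof -
  have "set (foldl (\<lambda>T _. filter (fact_ok fs es U T) T) T xs) \<subseteq> set T" for T and xs :: "fact list"
  proof (induction xs arbitrary: T)
    case (Cons x xs)
    show ?case using Cons[of "filter (fact_ok fs es U T) T"] by auto
  qed simp
  then show ?thesis by (simp add: stable_facts_def)
qed

text \<open>Converse of \<open>split_ok_sound\<close>, for one suitable tuple \<open>Y\<close>:
  solutions on the pieces have the same colors on \<open>Y\<close> and meet nowhere else, so they
  can be glued.\<close>

lemma split_ok_glue:
  assumes dist: "distinct es" and cl: "closed_in (set es) (set X) (set D)"
    and ok: "split_ok es U T X D c s" and Y: "Y \<in> set U"
    and XY: "\<And>x e. x \<in> set X \<Longrightarrow> e \<in> set D \<Longrightarrow> inc x e \<Longrightarrow> x \<in> set Y"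
    and T: "\<And>p c s. p \<in> set (pieces Y es D) \<Longrightarrow> ((Y, p), c, s) \<in> set T \<Longrightarrow> feasible_fact fs ((Y, p), c, s)"
  shows "feasible fs (set X) (set D) (lookup X c) (lookup X s)"
proof -
  have clY: "closed_in (set es) (set Y) (set D)"
    using cl by (rule closed_in_mono) (use XY in blast)
  define ps where "ps = pieces Y es D"
  have ps: "\<And>p. p \<in> set ps \<Longrightarrow> p \<in> set (split Y es)" "(\<Union>p\<in>set ps. set p) = set D" "distinct ps"
    unfolding ps_def using pieces_split pieces_Union[OF dist clY] pieces_distinct[OF dist] by blast+
  obtain c' u where c': "\<And>x. x \<in> set X \<Longrightarrow> x \<in> set Y \<Longrightarrow> lookup Y c' x = lookup X c x"
    and u: "u \<in> set (sums U T Y c' ps)"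
    and us: "\<And>x. x \<in> set X \<Longrightarrow> lookup X s x = (if x \<in> set Y then lookup Y u x else 0)"
    and uc: "\<And>y e. y \<in> set Y \<Longrightarrow> y \<notin> set X \<Longrightarrow> e \<in> set D \<Longrightarrow> inc y e \<Longrightarrow> lookup Y u y = lookup Y c' y"
  proof -
    have "\<forall>x\<in>set X. (\<exists>e\<in>set D. inc x e) \<longrightarrow> x \<in> set Y" using XY by blast
    with ok Y have "\<exists>c'\<in>set U. (\<forall>x\<in>set X. x \<in> set Y \<longrightarrow> lookup Y c' x = lookup X c x) \<and>
       (\<exists>u\<in>set (sums U T Y c' ps).
          (\<forall>x\<in>set X. lookup X s x = (if x \<in> set Y then lookup Y u x else 0)) \<and>
          (\<forall>y\<in>set Y. y \<notin> set X \<and> (\<exists>e\<in>set D. inc y e) \<longrightarrow> lookup Y u y = lookup Y c' y))"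
      unfolding split_ok_def ps_def by blast
    then show thesis using that by blast
  qed
  obtain \<sigma> where \<sigma>: "\<And>p. p \<in> set ps \<Longrightarrow> ((Y, p), c', \<sigma> p) \<in> set T"
      "\<And>y. y \<in> set Y \<Longrightarrow> lookup Y u y = (\<Sum>p\<in>set ps. lookup Y (\<sigma> p) y)"
    using sums_complete[OF ps(3) u] by blast
  have "\<forall>p\<in>set ps. \<exists>\<gamma> w. solves fs (set Y) (set p) \<gamma> w \<and>
      (\<forall>y\<in>set Y. \<gamma> y = lookup Y c' y \<and> wsum w (set p) y = lookup Y (\<sigma> p) y)"
    using T[of _ c'] \<sigma>(1) unfolding ps_def feasible_fact_def feasible_def by fastforce
  then obtain \<Gamma> W where sol: "\<And>p. p \<in> set ps \<Longrightarrow> solves fs (set Y) (set p) (\<Gamma> p) (W p)"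
    and GY: "\<And>p y. p \<in> set ps \<Longrightarrow> y \<in> set Y \<Longrightarrow> \<Gamma> p y = lookup Y c' y"
    and WY: "\<And>p y. p \<in> set ps \<Longrightarrow> y \<in> set Y \<Longrightarrow> wsum (W p) (set p) y = lookup Y (\<sigma> p) y"
    by metis
  \<comment> \<open>An edge of \<open>D\<close> lies in exactly one piece, and a vertex outside
    \<open>Y\<close> touches at most one, so both choices are unambiguous.\<close>
  define w where "w e = W (SOME p. p \<in> set ps \<and> e \<in> set p) e" for e
  define \<gamma> where "\<gamma> v = (if v \<in> set X then lookup X c v else if v \<in> set Y then lookup Y c' v
      else \<Gamma> (SOME p. p \<in> set ps \<and> (\<exists>e\<in>set p. inc v e)) v)" for v
  have w: "w e = W p e" if "p \<in> set ps" "e \<in> set p" for p e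
  proof -
    have "(SOME p. p \<in> set ps \<and> e \<in> set p) = p"
      using that ps(1) split_disjoint[OF dist] by (intro some_equality) blast+
    then show ?thesis by (simp add: w_def)
  qed
  have notX: "v \<notin> set X" if "e \<in> set D" "inc v e" "v \<notin> set Y" for v e
    using XY that by blast
  have pD: "e \<in> set D" if "p \<in> set ps" "e \<in> set p" for p e
    using ps(2) that by blast
  \<comment> \<open>On \<open>Y\<close> all pieces use the colors \<open>c'\<close>, which agree
    with \<open>c\<close> on the common part with \<open>X\<close>; outside \<open>Y\<close> only
    the piece \<open>p\<close> touches the vertex.\<close>
  have \<gamma>: "\<gamma> v = \<Gamma> p v" if p: "p \<in> set ps" "e \<in> set p" and v: "inc v e" for p e v
  proof (cases "v \<in> set Y")
    case True
    then show ?thesis using GY[OF p(1)] c' by (auto simp: \<gamma>_def)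
  next
    case False
    have "(SOME p. p \<in> set ps \<and> (\<exists>e\<in>set p. inc v e)) = p"
    proof (rule some_equality)
      show "p \<in> set ps \<and> (\<exists>e\<in>set p. inc v e)" using p v by blast
      fix q assume "q \<in> set ps \<and> (\<exists>e\<in>set q. inc v e)"
      then obtain e' where "q \<in> set ps" "e' \<in> set q" "inc v e'" by blast
      then show "q = p"
        using split_share[OF dist ps(1) ps(1), of q p e' e] p v False by (auto simp: share_iff)
    qed
    then show ?thesis using False notX[OF pD[OF p] v False] by (simp add: \<gamma>_def)
  qed
  have wp: "wsum w (set p) v = wsum (W p) (set p) v" if "p \<in> set ps" for p v
    by (rule wsum_cong) (rule w[OF that])
  have sumY: "wsum w (set D) y = lookup Y u y" if "y \<in> set Y" for y
  proof -
    have "wsum w (set D) y = (\<Sum>p\<in>set ps. wsum w (set p) y)"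
      unfolding ps_def by (rule wsum_pieces[OF dist clY])
    also have "\<dots> = (\<Sum>p\<in>set ps. lookup Y (\<sigma> p) y)"
      by (rule sum.cong) (simp_all add: wp WY that)
    finally show ?thesis using \<sigma>(2)[OF that] by simp
  qed
  have "solves fs (set X) (set D) \<gamma> w"
    unfolding solves_def
  proof (intro conjI ballI allI impI)
    fix e assume "e \<in> set D"
    then obtain p where p: "p \<in> set ps" "e \<in> set p" using ps(2) by blast
    then have "allowed fs e (W p e)" "\<Gamma> p (fst e) \<noteq> \<Gamma> p (snd e)"
      using sol[OF p(1)] unfolding solves_def by blast+
    then show "allowed fs e (w e)" "\<gamma> (fst e) \<noteq> \<gamma> (snd e)"
      using w[OF p] \<gamma>[OF p] by (simp_all add: inc_def)
  next
    fix v assume "v \<notin> set X \<and> (\<exists>e\<in>set D. inc v e)"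
    then obtain e where v: "v \<notin> set X" "e \<in> set D" "inc v e" by blast
    then obtain p where p: "p \<in> set ps" "e \<in> set p" using ps(2) by blast
    \<comment> \<open>A vertex of \<open>Y\<close> may collect contributions from several pieces,
      and \<open>uc\<close> makes their total its color; any other vertex is settled within its
      piece.\<close>
    show "wsum w (set D) v = \<gamma> v"
    proof (cases "v \<in> set Y")
      case True
      then show ?thesis using sumY uc v by (simp add: \<gamma>_def)
    next
      case False
      have "wsum w (set D) v = wsum w (set p) v"
      proof (rule wsum_local)
        show "set p \<subseteq> set D" using ps(2) p by blast
        fix e' assume "e' \<in> set D" "inc v e'"
        then show "e' \<in> set p"
          using closed_in_split[OF dist ps(1)[OF p(1)]] p v False cl unfolding closed_in_def by blast
      qed
      also have "\<dots> = \<Gamma> p v"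
        using sol[OF p(1)] p v False unfolding wp[OF p(1)] solves_def by blast
      finally show ?thesis using \<gamma>[OF p v(3)] by simp
    qed
  qed
  moreover have "\<gamma> x = lookup X c x" "wsum w (set D) x = lookup X s x" if "x \<in> set X" for x
  proof -
    show "\<gamma> x = lookup X c x" using that by (simp add: \<gamma>_def)
    show "wsum w (set D) x = lookup X s x"
    proof (cases "x \<in> set Y")
      case True
      then show ?thesis using sumY us that by simp
    next
      case False
      then have "wsum w (set D) x = 0" using XY that by (intro wsum_zero) blast
      then show ?thesis using us that False by simp
    qed
  qed
  ultimately show ?thesis unfolding feasible_def by blast
qed

section \<open>Trees\<close>

definition is_path :: "'a set set \<Rightarrow> 'a list \<Rightarrow> bool" where
  "is_path F p \<longleftrightarrow> distinct p \<and> (\<forall>i. Suc i < length p \<longrightarrow> {p ! i, p ! Suc i} \<in> F)"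

text \<open>The first vertex of a longest path is a leaf.\<close>

lemma tree_leaf:
  assumes tree: "is_tree I F" and "F \<noteq> {}"
  obtains a b where "{a, b} \<in> F" "a \<noteq> b" "\<And>z. {a, z} \<in> F \<Longrightarrow> z = b"
proof -
  have fin: "finite I" and F: "\<And>e. e \<in> F \<Longrightarrow> e \<subseteq> I \<and> card e = 2" and nc: "\<And>c. \<not> is_cycle F c"
    using tree unfolding is_tree_def simple_graph_def by blast+
  let ?P = "\<lambda>p. is_path F p \<and> 2 \<le> length p"
  have bound: "length p \<le> card I" if "?P p" for p
  proof -
    have "set p \<subseteq> I"
    proof
      fix x assume "x \<in> set p"
      then obtain i where i: "i < length p" "x = p ! i" by (metis in_set_conv_nth)
      show "x \<in> I"
      proof (cases "Suc i < length p")
        case True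
        then show ?thesis using that i F[of "{p ! i, p ! Suc i}"] by (auto simp: is_path_def)
      next
        case False
        then have "Suc (i - 1) = i" "Suc (i - 1) < length p" using that i by auto
        then have "{p ! (i - 1), p ! i} \<in> F" using that unfolding is_path_def by metis
        then show ?thesis using F i by blast
      qed
    qed
    then show ?thesis
      using that fin by (metis card_mono distinct_card is_path_def)
  qed
  obtain e where e: "e \<in> F" using assms(2) by blast
  then obtain x y where "e = {x, y}" "x \<noteq> y" using F by (metis card_2_iff)
  then have "?P [x, y]" using e by (auto simp: is_path_def less_Suc_eq)
  then obtain p where p: "?P p" and pmax: "\<And>q. ?P q \<Longrightarrow> length q \<le> length p"
    using ex_has_greatest_nat[of ?P "[x, y]" length "Suc (card I)"] bound
    by (meson le_imp_less_Suc)
  have step: "{p ! i, p ! Suc i} \<in> F" if "Suc i < length p" for i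
    using p that by (simp add: is_path_def)
  have leaf: "z = p ! 1" if z: "{p ! 0, z} \<in> F" for z
  proof -
    have "z \<noteq> p ! 0" using F[OF z] by auto
    \<comment> \<open>A neighbour of the first vertex off the path would prolong the path, and one
      at a position \<open>j \<ge> 2\<close> would close a cycle with the first \<open>Suc j\<close>
      vertices.\<close>
    have "z \<in> set p"
    proof (rule ccontr)
      assume "z \<notin> set p"
      moreover have "{(z # p) ! i, (z # p) ! Suc i} \<in> F" if "Suc i < length (z # p)" for i
        using that z step by (cases i) (auto simp: insert_commute)
      ultimately have "?P (z # p)" using p by (simp add: is_path_def)
      then show False using pmax by fastforce
    qed
    then obtain j where j: "j < length p" "z = p ! j" by (metis in_set_conv_nth)
    have "j = 1"
    proof (rule ccontr)
      assume "j \<noteq> 1"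
      moreover have "j \<noteq> 0" using j \<open>z \<noteq> p ! 0\<close> by metis
      ultimately have "2 \<le> j" by simp
      let ?c = "take (Suc j) p"
      have len: "length ?c = Suc j" using j by simp
      have "is_cycle F ?c"
        unfolding is_cycle_def
      proof (intro conjI allI impI)
        show "3 \<le> length ?c" using len \<open>2 \<le> j\<close> by simp
        show "distinct ?c" using p by (simp add: is_path_def)
        fix i assume "i < length ?c"
        then have "i \<le> j" using len by simp
        show "{?c ! i, ?c ! (Suc i mod length ?c)} \<in> F"
        proof (cases "i = j")
          case True
          then show ?thesis using z j unfolding len by (simp add: insert_commute)
        next
          case False
          then show ?thesis using \<open>i \<le> j\<close> j step[of i] unfolding len by simp
        qed
      qed
      then show False using nc by blast
    qed
    then show ?thesis using j by simp
  qed
  have "{p ! 0, p ! 1} \<in> F" using step[of 0] p by simp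
  moreover have "p ! 0 \<noteq> p ! 1"
    using p nth_eq_iff_index_eq[of p 0 1] by (auto simp: is_path_def simp del: length_0_conv length_greater_0_conv)
  ultimately show thesis using that leaf by blast
qed

lemma tree_remove_leaf:
  assumes tree: "is_tree I F" and ab: "{a, b} \<in> F" "a \<noteq> b" and leaf: "\<And>z. {a, z} \<in> F \<Longrightarrow> z = b"
  shows "is_tree (I - {a}) {e \<in> F. a \<notin> e}"
proof -
  let ?R = "{(x, y). {x, y} \<in> F}" and ?R' = "{(x, y). {x, y} \<in> {e \<in> F. a \<notin> e}}"
  have F: "\<And>e. e \<in> F \<Longrightarrow> e \<subseteq> I \<and> card e = 2"
    using tree unfolding is_tree_def simple_graph_def by blast
  \<comment> \<open>A walk enters and leaves the leaf \<open>a\<close> only through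
    \<open>b\<close>. While it visits \<open>a\<close>, the invariant records that \<open>b\<close>
    is reachable instead, which cuts the visits out.\<close>
  have walk: "(if x = a then (u, b) \<in> ?R'\<^sup>* else (u, x) \<in> ?R'\<^sup>*)" if "(u, x) \<in> ?R\<^sup>*" "u \<noteq> a" for u x
    using that
  proof (induction rule: rtrancl_induct)
    case base
    then show ?case by simp
  next
    case (step x y)
    have xy: "{x, y} \<in> F" using step by simp
    then have "x \<noteq> y" using F by fastforce
    show ?case
    proof (cases "y = a")
      case True
      then have "x = b" using xy leaf by (simp add: insert_commute)
      then show ?thesis using step True ab by simp
    next
      case False
      show ?thesis
      proof (cases "x = a")
        case True
        then show ?thesis using step leaf xy False by auto
      next
        case False
        then have "(x, y) \<in> ?R'" using xy \<open>y \<noteq> a\<close> by auto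
        then show ?thesis using step False \<open>y \<noteq> a\<close> by (auto intro: rtrancl_into_rtrancl)
      qed
    qed
  qed
  have "connected_graph (I - {a}) {e \<in> F. a \<notin> e}"
    unfolding connected_graph_def
  proof (intro conjI ballI)
    show "I - {a} \<noteq> {}" using F[OF ab(1)] ab(2) by auto
  next
    fix u v assume uv: "u \<in> I - {a}" "v \<in> I - {a}"
    then have "(u, v) \<in> ?R\<^sup>*" using tree unfolding is_tree_def connected_graph_def by blast
    from walk[OF this] show "(u, v) \<in> ?R'\<^sup>*" using uv by simp
  qed
  moreover have "simple_graph (I - {a}) {e \<in> F. a \<notin> e}"
    using tree F unfolding is_tree_def simple_graph_def by blast
  moreover have "\<nexists>c. is_cycle {e \<in> F. a \<notin> e} c"
    using tree unfolding is_tree_def is_cycle_def by blast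
  ultimately show ?thesis unfolding is_tree_def by blast
qed

text \<open>Roots the tree by removing leaves one after the other: a leaf gets its neighbour as
  parent and a rank higher by one.\<close>

lemma tree_parent:
  assumes "is_tree I F"
  shows "\<exists>par rank. \<forall>e\<in>F. \<exists>a. e = {a, par a} \<and> rank (par a) < (rank a :: nat)"
  using assms
proof (induction "card I" arbitrary: I F rule: less_induct)
  case less
  show ?case
  proof (cases "F = {}")
    case False
    from tree_leaf[OF less.prems this] obtain a b
      where ab: "{a, b} \<in> F" "a \<noteq> b" and leaf: "\<And>z. {a, z} \<in> F \<Longrightarrow> z = b" by blast
    have fin: "finite I" and F: "\<And>e. e \<in> F \<Longrightarrow> e \<subseteq> I \<and> card e = 2"
      using less.prems unfolding is_tree_def simple_graph_def by blast+
    have "a \<in> I" using F[OF ab(1)] by blast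
    then have "card (I - {a}) < card I" using fin by (intro card_Diff1_less)
    from less.hyps[OF this tree_remove_leaf[OF less.prems ab leaf]]
    obtain par and rank :: "'a \<Rightarrow> nat"
      where IH: "\<And>e. e \<in> F \<Longrightarrow> a \<notin> e \<Longrightarrow> \<exists>c. e = {c, par c} \<and> rank (par c) < rank c" by auto
    show ?thesis
    proof (rule exI, rule exI, rule ballI)
      fix e assume e: "e \<in> F"
      let ?par = "par(a := b)" and ?rank = "rank(a := Suc (rank b))"
      show "\<exists>c. e = {c, ?par c} \<and> ?rank (?par c) < ?rank c"
      proof (cases "a \<in> e")
        case True
        then obtain z where "e = {a, z}" using F[OF e] by (auto simp: card_2_iff)
        then have "e = {a, b}" using leaf e by blast
        then show ?thesis using ab(2) by (intro exI[of _ a]) auto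
      next
        case False
        from IH[OF e this] obtain c where "e = {c, par c}" "rank (par c) < rank c" by blast
        then show ?thesis using False by (intro exI[of _ c]) auto
      qed
    qed
  qed simp
qed

text \<open>\<open>par\<close> is total, so the parent relation is cut down to tree edges. As a
  relation it yields subtrees by its reflexive transitive closure.\<close>

lemma tree_up:
  assumes "is_tree I F"
  obtains up and rank :: "'a \<Rightarrow> nat"
  where "\<And>a b. (a, b) \<in> up \<Longrightarrow> a \<in> I \<and> b \<in> I \<and> rank b < rank a"
    "\<And>a b c. (a, b) \<in> up \<Longrightarrow> (a, c) \<in> up \<Longrightarrow> b = c"
    "\<And>a b. {a, b} \<in> F \<Longrightarrow> (a, b) \<in> up \<or> (b, a) \<in> up"
proof -
  obtain par and rank :: "'a \<Rightarrow> nat"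
    where par: "\<And>e. e \<in> F \<Longrightarrow> \<exists>a. e = {a, par a} \<and> rank (par a) < rank a"
    using tree_parent[OF assms] by metis
  have F: "\<And>e. e \<in> F \<Longrightarrow> e \<subseteq> I" using assms unfolding is_tree_def simple_graph_def by blast
  let ?up = "{(a, b). {a, b} \<in> F \<and> b = par a \<and> rank b < rank a}"
  show thesis
  proof (rule that[of ?up rank])
    show "a \<in> I \<and> b \<in> I \<and> rank b < rank a" if "(a, b) \<in> ?up" for a b
      using that F[of "{a, b}"] by auto
    show "b = c" if "(a, b) \<in> ?up" "(a, c) \<in> ?up" for a b c
      using that by simp
    show "(a, b) \<in> ?up \<or> (b, a) \<in> ?up" if ab: "{a, b} \<in> F" for a b
    proof -
      obtain c where c: "{a, b} = {c, par c}" "rank (par c) < rank c" using par[OF ab] by blast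
      then have "a = c \<and> b = par c \<or> b = c \<and> a = par c" by (auto simp: doubleton_eq_iff)
      then show ?thesis using c ab by (auto simp: insert_commute)
    qed
  qed
qed

section \<open>Completeness for graphs of small treewidth\<close>

text \<open>Tuples have to agree with bags only on \<open>V\<close>, which permits padding. The
  proof is by induction on subtrees of the rooted decomposition: a surviving fact is feasible if its
  boundary is the bag of \<open>t\<close> and its other vertices occur only below \<open>t\<close>.
  If its class is not covered by the bag, it belongs to the subtree of one child, whose bag serves
  as \<open>Y\<close>.\<close>

lemma consistent_complete:
  assumes dist: "distinct es" and U: "set U = tuples N K"
    and td: "tree_decomposition V E I F B"
    and es: "\<And>e. e \<in> set es \<Longrightarrow> {fst e, snd e} \<in> E \<and> {fst e, snd e} \<subseteq> V"
    and bags: "\<And>t. t \<in> I \<Longrightarrow> \<exists>X\<in>set U. \<forall>v\<in>V. v \<in> set X \<longleftrightarrow> v \<in> B t"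
    and cons: "consistent fs es U"
  shows "solvable fs (set es)"
proof -
  have tree: "is_tree I F" and conn: "\<And>v. v \<in> V \<Longrightarrow> connected_graph {t \<in> I. v \<in> B t} {e \<in> F. e \<subseteq> {t \<in> I. v \<in> B t}}"
    and cover: "\<And>e. e \<in> E \<Longrightarrow> \<exists>t\<in>I. e \<subseteq> B t"
    using td unfolding tree_decomposition_def Let_def by blast+
  have fin: "finite I" and I: "connected_graph I F" and FI: "\<And>e. e \<in> F \<Longrightarrow> e \<subseteq> I"
    using tree unfolding is_tree_def simple_graph_def by blast+
  obtain up and rank :: "_ \<Rightarrow> nat" where
    up: "\<And>a b. (a, b) \<in> up \<Longrightarrow> a \<in> I \<and> b \<in> I \<and> rank b < rank a"
    and up_fun: "\<And>a b c. (a, b) \<in> up \<Longrightarrow> (a, c) \<in> up \<Longrightarrow> b = c"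
    and up_F: "\<And>a b. {a, b} \<in> F \<Longrightarrow> (a, b) \<in> up \<or> (b, a) \<in> up"
    using tree_up[OF tree] by blast
  define below where "below t = {z. (z, t) \<in> up\<^sup>*}" for t
  have below_I: "below t \<subseteq> insert t I" for t
  proof
    fix z assume "z \<in> below t"
    then have "(z, t) \<in> up\<^sup>*" by (simp add: below_def)
    then show "z \<in> insert t I" by (cases rule: converse_rtranclE) (use up in auto)
  qed
  have rank_le: "rank t \<le> rank z" if "z \<in> below t" for z t
  proof -
    from that have "(z, t) \<in> up\<^sup>*" by (simp add: below_def)
    then show ?thesis by (induction rule: rtrancl_induct) (use up in fastforce)+
  qed
  \<comment> \<open>A connected set of nodes can leave the subtree of \<open>t\<close> only over the
    edge from \<open>t\<close> to its parent.\<close>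
  have cross: "\<exists>t'. (t, t') \<in> up \<and> t \<in> S \<and> t' \<in> S"
    if S: "connected_graph S {e \<in> F. e \<subseteq> S}" and z: "z \<in> S" "z \<in> below t" and s: "s \<in> S" "s \<notin> below t" for S t z s
  proof (rule ccontr)
    assume no: "\<not> ?thesis"
    have "(z, s) \<in> {(x, y). {x, y} \<in> {e \<in> F. e \<subseteq> S}}\<^sup>*"
      using S z s unfolding connected_graph_def by blast
    then have "s \<in> below t"
    proof (induction rule: rtrancl_induct)
      case base
      show ?case by (rule z)
    next
      case (step x y)
      then have xy: "{x, y} \<in> F" "x \<in> S" "y \<in> S" by auto
      from up_F[OF xy(1)] show ?case
      proof
        assume xy': "(x, y) \<in> up"
        have "(x, t) \<in> up\<^sup>*" using step by (simp add: below_def)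
        then show ?thesis
        proof (cases rule: converse_rtranclE)
          case base
          then show ?thesis using no xy' xy by blast
        next
          case (step x')
          then show ?thesis using up_fun xy' by (auto simp: below_def)
        qed
      next
        assume "(y, x) \<in> up"
        then show ?thesis using step by (auto simp: below_def intro: converse_rtrancl_into_rtrancl)
      qed
    qed
    then show False using s by blast
  qed
  define occ where "occ v = {t \<in> I. v \<in> B t}" for v
  have occ: "connected_graph (occ v) {e \<in> F. e \<subseteq> occ v}" if "v \<in> V" for v
    using conn[OF that] by (simp add: occ_def)
  have occ_ne: "occ v \<noteq> {}" if "v \<in> V" for v
    using occ[OF that] by (simp add: connected_graph_def)
  have inV: "v \<in> V" if "e \<in> set es" "inc v e" for v e
    using es[OF that(1)] that(2) by (auto simp: inc_def)
  have meet: "\<exists>t. t \<in> occ u \<and> t \<in> occ v" if e: "e \<in> set es" "inc u e" "inc v e" for e u v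
  proof -
    obtain t where "t \<in> I" "{fst e, snd e} \<subseteq> B t" using cover es[OF e(1)] by blast
    then show ?thesis using e(2,3) by (auto simp: inc_def occ_def)
  qed
  let ?T = "stable_facts fs es U"
  have main: "feasible_fact fs ((X, D), c, s)"
    if "t \<in> I" "\<forall>v\<in>V. v \<in> set X \<longleftrightarrow> v \<in> B t" "((X, D), c, s) \<in> set ?T"
      "\<forall>e\<in>set D. \<forall>v. inc v e \<and> v \<notin> set X \<longrightarrow> occ v \<subseteq> below t" for t X D c s
    using that
  proof (induction "card (below t)" arbitrary: t X D c s rule: less_induct)
    case less
    have "((X, D), c, s) \<in> set (all_facts es U)" using less.prems(3) stable_facts_subset by blast
    then have D: "D \<in> set (split X es)" by (simp add: mem_all_facts)
    have Des: "set D \<subseteq> set es" by (rule split_subset[OF dist D])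
    have ok: "fact_ok fs es U ?T ((X, D), c, s)" by (rule stable_facts_fixed[OF less.prems(3)])
    show ?case
    proof (cases "\<forall>e\<in>set D. fst e \<in> set X \<and> snd e \<in> set X")
      case True
      then have "covered_ok fs X D c s" using ok by (simp add: fact_ok_def)
      then show ?thesis using covered_ok_iff[OF dist D True] by (simp add: feasible_fact_def)
    next
      case False
      then have "\<exists>e\<in>set D. \<exists>v. inc v e \<and> v \<notin> set X" unfolding inc_def by blast
      then obtain e0 v0 where e0: "e0 \<in> set D" "inc v0 e0" "v0 \<notin> set X" by blast
      have notB: "t \<notin> occ v" if "e \<in> set D" "inc v e" "v \<notin> set X" for e v
        using that inV[of e v] Des less.prems(2) unfolding occ_def by blast
      \<comment> \<open>As \<open>v0\<close> is not in the bag of \<open>t\<close>, it occurs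
        strictly below \<open>t\<close>; \<open>t'\<close> will be the child of \<open>t\<close> on
        the way to such an occurrence.\<close>
      obtain z where z: "z \<in> occ v0" using occ_ne inV[of e0 v0] e0 Des by blast
      have "z \<in> below t" using less.prems(4) e0 z by blast
      moreover have "z \<noteq> t" using notB[OF e0] z by blast
      ultimately obtain t' where t': "(t', t) \<in> up" "z \<in> below t'"
        by (auto simp: below_def elim: rtranclE)
      have "t' \<in> I" using up t' by blast
      have tt': "t \<notin> below t'" using rank_le[of t t'] up[OF t'(1)] by auto
      \<comment> \<open>Occurrences of \<open>v\<close> outside the subtree of \<open>t'\<close>
        would force \<open>v\<close> into the bag of the parent \<open>t\<close>, but
        \<open>X\<close> lacks \<open>v\<close>.\<close>
      have sub: "occ v \<subseteq> below t'" if h: "e \<in> set D" "inc v e" "v \<notin> set X" "x \<in> occ v" "x \<in> below t'" for e v x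
      proof (rule ccontr)
        assume "\<not> occ v \<subseteq> below t'"
        then obtain s where "s \<in> occ v" "s \<notin> below t'" by blast
        then obtain t'' where "(t', t'') \<in> up" "t'' \<in> occ v"
          using cross[OF occ h(4,5)] inV[of e v] h(1,2) Des by blast
        then show False using up_fun[OF t'(1)] notB[OF h(1-3)] by blast
      qed
      let ?A = "{e. (\<exists>v. inc v e \<and> v \<notin> set X) \<and> (\<forall>v. inc v e \<and> v \<notin> set X \<longrightarrow> occ v \<subseteq> below t')}"
      \<comment> \<open>The ends of an edge occur together in some bag, so those outside
        \<open>X\<close> occur below the same child. Connectivity of \<open>D\<close> then carries
        this to all its edges.\<close>
      have spread: "e \<in> ?A" if e: "e \<in> set D" "inc v e" "v \<notin> set X" "occ v \<subseteq> below t'" for e v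
      proof -
        have "occ u \<subseteq> below t'" if u: "inc u e" "u \<notin> set X" for u
        proof -
          obtain x where "x \<in> occ v" "x \<in> occ u" using meet[of e v u] e u Des by blast
          then show ?thesis using sub[OF e(1) u] e(4) by blast
        qed
        then show ?thesis using e by blast
      qed
      have "set D \<subseteq> ?A"
      proof (rule connD[OF split_conn[OF dist D] e0(1)])
        show "e0 \<in> ?A" using e0 sub[OF e0 z t'(2)] by (rule spread)
        fix e e' assume e: "e \<in> set D" "e' \<in> set D" "e \<in> ?A" "share X e e'"
        then obtain v where "v \<notin> set X" "inc v e" "inc v e'" unfolding share_iff by blast
        then show "e' \<in> ?A" using e spread[of e' v] by blast
      qed
      then have A: "\<And>e. e \<in> set D \<Longrightarrow> \<exists>v. inc v e \<and> v \<notin> set X"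
        and A': "\<And>e v. e \<in> set D \<Longrightarrow> inc v e \<Longrightarrow> v \<notin> set X \<Longrightarrow> occ v \<subseteq> below t'"
        by blast+
      obtain Y where Y: "Y \<in> set U" "\<forall>v\<in>V. v \<in> set Y \<longleftrightarrow> v \<in> B t'" using bags[OF \<open>t' \<in> I\<close>] by blast
      \<comment> \<open>An edge of \<open>D\<close> joins \<open>x\<close> to a vertex outside
        \<open>X\<close>, so \<open>x\<close> occurs somewhere below \<open>t'\<close>. It also
        occurs at \<open>t\<close>, hence at \<open>t'\<close>, which lies between.\<close>
      have XY: "x \<in> set Y" if x: "x \<in> set X" and e: "e \<in> set D" "inc x e" for x e
      proof -
        obtain v where v: "inc v e" "v \<notin> set X" using A[OF e(1)] by blast
        have xV: "x \<in> V" using inV[of e x] e Des by blast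
        obtain y where y: "y \<in> occ v" "y \<in> occ x" using meet[of e v x] v e Des by blast
        then have "y \<in> below t'" using A'[OF e(1) v] by blast
        moreover have "t \<in> occ x" using less.prems(1,2) x xV by (simp add: occ_def)
        ultimately have "t' \<in> occ x" using cross[OF occ[OF xV] y(2) _ _ tt'] by blast
        then show ?thesis using Y xV by (simp add: occ_def)
      qed
      have card: "card (below t') < card (below t)"
      proof (rule psubset_card_mono)
        show "finite (below t)" using below_I fin by (meson finite.insertI finite_subset)
        have "t \<in> below t" by (simp add: below_def)
        moreover have "below t' \<subseteq> below t" using t'(1) by (auto simp: below_def)
        ultimately show "below t' \<subset> below t" using tt' by blast
      qed
      have cl: "closed_in (set es) (set X) (set D)" by (rule closed_in_split[OF dist D])
      have clY: "closed_in (set es) (set Y) (set D)" using cl XY by (rule closed_in_mono)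
      have "split_ok es U ?T X D c s" using ok False by (auto simp: fact_ok_def)
      then have "feasible fs (set X) (set D) (lookup X c) (lookup X s)"
      proof (rule split_ok_glue[OF dist cl _ Y(1) XY])
        fix p c s assume p: "p \<in> set (pieces Y es D)" "((Y, p), c, s) \<in> set ?T"
        have pD: "set p \<subseteq> set D" using pieces_Union[OF dist clY] p(1) by blast
        show "feasible_fact fs ((Y, p), c, s)"
        proof (rule less.hyps[OF card \<open>t' \<in> I\<close> Y(2) p(2)], intro ballI allI impI)
          fix e v assume "e \<in> set p" "inc v e \<and> v \<notin> set Y"
          then show "occ v \<subseteq> below t'" using A'[of e v] XY[of v e] pD by blast
        qed
      qed
      then show ?thesis by (simp add: feasible_fact_def)
    qed
  qed
  have "I \<noteq> {}" using I by (simp add: connected_graph_def)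
  then obtain r where r: "r \<in> I" "\<And>t. t \<in> I \<Longrightarrow> rank r \<le> rank t"
    using ex_has_least_nat[of "\<lambda>t. t \<in> I" _ rank] by blast
  \<comment> \<open>A node of least rank has no parent, so the connected set of all nodes cannot
    leave its subtree.\<close>
  have root: "I \<subseteq> below r"
  proof (rule ccontr)
    assume "\<not> I \<subseteq> below r"
    then obtain s where "s \<in> I" "s \<notin> below r" by blast
    moreover have "{e \<in> F. e \<subseteq> I} = F" using FI by blast
    moreover have "r \<in> below r" by (simp add: below_def)
    ultimately obtain t where "(r, t) \<in> up" using cross[of I r r s] I r(1) by auto
    then show False using up[of r t] r(2)[of t] by auto
  qed
  obtain Y where Y: "Y \<in> set U" "\<forall>v\<in>V. v \<in> set Y \<longleftrightarrow> v \<in> B r" using bags[OF r(1)] by blast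
  have "feasible fs (set []) (set es) (lookup [] []) (lookup [] [])"
  proof (rule split_ok_glue[OF dist _ _ Y(1)])
    show "closed_in (set es) (set []) (set es)" by (auto simp: closed_in_def)
    show "split_ok es U ?T [] es [] []" using cons by (simp add: consistent_def)
    fix p c s assume p: "p \<in> set (pieces Y es es)" "((Y, p), c, s) \<in> set ?T"
    show "feasible_fact fs ((Y, p), c, s)"
      by (rule main[OF r(1) Y(2) p(2)]) (use root in \<open>auto simp: occ_def\<close>)
  qed auto
  then show ?thesis using solvable_iff_feasible by simp
qed

section \<open>Graphs and their edge lists\<close>

definition adj :: "nat \<Rightarrow> nat set set \<Rightarrow> bool list list" where
  "adj n E = map (\<lambda>i. map (\<lambda>j. {i, j} \<in> E) [0..<n]) [0..<n]"

lemma enc_adj: "enc (adj n E) = encode_graph n E"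
  by (simp add: adj_def encode_graph_def encode_matrix_def enc_list_def enc_bool_def comp_def)

lemma length_adj [simp]: "length (adj n E) = n"
  by (simp add: adj_def)

lemma zip_map_self: "zip xs (map f xs) = map (\<lambda>i. (i, f i)) xs"
  by (induction xs) auto

lemma edges_adj:
  "edges (adj n E) = concat (map (\<lambda>i. map (\<lambda>j. (i, j)) (filter (\<lambda>j. {i, j} \<in> E \<and> i < j) [0..<n])) [0..<n])"
  by (simp add: edges_def adj_def zip_map_self filter_map comp_def)

lemma set_edges_adj: "set (edges (adj n E)) = {(i, j). i < j \<and> j < n \<and> {i, j} \<in> E}"
  by (auto simp: edges_adj image_iff)

lemma distinct_edges_adj: "distinct (edges (adj n E))"
proof -
  have "distinct (concat (map (\<lambda>i. map (\<lambda>j. (i, j)) (g i)) xs))"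
    if "distinct xs" "\<And>i. distinct (g i)" for xs :: "nat list" and g :: "nat \<Rightarrow> nat list"
    using that(1) by (induction xs) (auto simp: distinct_map that(2) inj_on_def)
  then show ?thesis unfolding edges_adj by simp
qed

definition weight_of :: "(edge \<Rightarrow> bool) \<Rightarrow> nat set \<Rightarrow> nat" where
  "weight_of w e = (if w (Min e, Max e) then 1 else 0)"

context
  fixes n :: nat and E :: "nat set set"
  assumes graph: "simple_graph {..<n} E"
begin

lemma edge_cases:
  assumes "e \<in> E"
  obtains i j where "e = {i, j}" "(i, j) \<in> set (edges (adj n E))" "i < j"
proof -
  have "e \<subseteq> {..<n}" "card e = 2" using graph assms by (auto simp: simple_graph_def)
  then obtain x y where xy: "e = {x, y}" "x \<noteq> y" "x < n" "y < n" by (auto simp: card_2_iff)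
  show thesis
  proof (cases "x < y")
    case True
    then show thesis using that[of x y] xy assms by (auto simp: set_edges_adj)
  next
    case False
    then show thesis using that[of y x] xy assms by (auto simp: set_edges_adj insert_commute)
  qed
qed

text \<open>Forgetting the order of the ends is injective on the edge list because the smaller end
  comes first; this turns the sum over sets into a count over pairs.\<close>

lemma color_eq_wsum:
  assumes w: "\<And>e. e \<in> E \<Longrightarrow> w e \<in> {0, 1}"
    and w': "\<And>e. e \<in> set (edges (adj n E)) \<Longrightarrow> w' e \<longleftrightarrow> w {fst e, snd e} = 1"
  shows "color E w v = wsum w' (set (edges (adj n E))) v"
proof -
  let ?es = "set (edges (adj n E))" and ?h = "\<lambda>e :: edge. {fst e, snd e}"
  have img: "{e \<in> E. v \<in> e} = ?h ` {e \<in> ?es. inc v e}"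
  proof (rule equalityI; rule subsetI)
    fix e assume e: "e \<in> {e \<in> E. v \<in> e}"
    then obtain i j where "e = {i, j}" "(i, j) \<in> ?es" using edge_cases by blast
    then show "e \<in> ?h ` {e \<in> ?es. inc v e}"
      using e by (intro image_eqI[of _ _ "(i, j)"]) (auto simp: inc_def)
  next
    fix e assume "e \<in> ?h ` {e \<in> ?es. inc v e}"
    then show "e \<in> {e \<in> E. v \<in> e}" by (auto simp: set_edges_adj inc_def)
  qed
  have inj: "inj_on ?h {e \<in> ?es. inc v e}"
  proof (rule inj_onI)
    fix e e' assume "e \<in> {e \<in> ?es. inc v e}" "e' \<in> {e \<in> ?es. inc v e}" "?h e = ?h e'"
    then show "e = e'" by (cases e; cases e') (auto simp: set_edges_adj doubleton_eq_iff)
  qed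
  have "color E w v = (\<Sum>e\<in>{e \<in> ?es. inc v e}. w (?h e))"
    unfolding color_def img sum.reindex[OF inj] by simp
  also have "\<dots> = (\<Sum>e\<in>{e \<in> ?es. inc v e}. if w' e then 1 else 0)"
  proof (rule sum.cong)
    fix e assume e: "e \<in> {e \<in> ?es. inc v e}"
    then have "?h e \<in> E" by (auto simp: set_edges_adj)
    then show "w (?h e) = (if w' e then 1 else 0)" using w[of "?h e"] w'[of e] e by auto
  qed simp
  also have "\<dots> = card {e \<in> {e \<in> ?es. inc v e}. w' e}"
    by (simp only: card_eq_sum sum.inter_filter [symmetric] finite_Collect_conjI finite_set Collect_mem_eq disjI1)
  also have "{e \<in> {e \<in> ?es. inc v e}. w' e} = {e \<in> ?es. inc v e \<and> w' e}" by blast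
  finally show ?thesis by (simp add: wsum_def)
qed

lemma proper_weight_imp_solvable:
  assumes "proper_weight E w" shows "solvable [] (set (edges (adj n E)))"
  unfolding solvable_def
proof (intro exI ballI conjI)
  let ?w = "\<lambda>e. w {fst e, snd e} = 1"
  fix e assume e: "e \<in> set (edges (adj n E))"
  show "allowed [] e (?w e)" by (simp add: allowed_def)
  have "{fst e, snd e} \<in> E" using e by (auto simp: set_edges_adj)
  then have "color E w (fst e) \<noteq> color E w (snd e)" using assms by (simp add: proper_weight_def)
  moreover have "color E w v = wsum ?w (set (edges (adj n E))) v" for v
    using assms by (intro color_eq_wsum) (auto simp: proper_weight_def)
  ultimately show "wsum ?w (set (edges (adj n E))) (fst e) \<noteq> wsum ?w (set (edges (adj n E))) (snd e)"
    by simp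
qed

lemma proper_weight_weight_of:
  assumes "\<And>e. e \<in> set (edges (adj n E)) \<Longrightarrow>
    wsum w (set (edges (adj n E))) (fst e) \<noteq> wsum w (set (edges (adj n E))) (snd e)"
  shows "proper_weight E (weight_of w)"
  unfolding proper_weight_def
proof (intro conjI ballI allI impI)
  show "weight_of w e \<in> {0, 1}" for e by (simp add: weight_of_def)
  have col: "color E (weight_of w) v = wsum w (set (edges (adj n E))) v" for v
  proof (rule color_eq_wsum)
    show "weight_of w e \<in> {0, 1}" for e by (simp add: weight_of_def)
    fix e assume "e \<in> set (edges (adj n E))"
    then obtain i j where "e = (i, j)" "i < j" by (auto simp: set_edges_adj)
    then show "w e \<longleftrightarrow> weight_of w {fst e, snd e} = 1" by (simp add: weight_of_def)
  qed
  fix u v assume "{u, v} \<in> E"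
  then obtain i j where ij: "{u, v} = {i, j}" "(i, j) \<in> set (edges (adj n E))" "i < j"
    by (rule edge_cases)
  have "color E (weight_of w) i \<noteq> color E (weight_of w) j"
    using assms[OF ij(2)] unfolding col fst_conv snd_conv .
  moreover have "u = i \<and> v = j \<or> u = j \<and> v = i" using ij(1) unfolding doubleton_eq_iff .
  ultimately show "color E (weight_of w) u \<noteq> color E (weight_of w) v"
    by (elim disjE conjE) simp_all
qed

end

section \<open>Correctness of one round\<close>

text \<open>Every edge gets one entry, so the forced weights form a complete weight
  assignment.\<close>

lemma greedy_fst: "map fst (greedy es U) = rev es"
proof -
  have "map fst (foldl (\<lambda>fs e. (e, consistent ((e, True) # fs) es' U) # fs) a es) = rev es @ map fst a" for a es es'
    by (induction es arbitrary: a) auto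
  then show ?thesis by (simp add: greedy_def)
qed

lemma set_keys: "map fst fs = rev es \<Longrightarrow> set es = fst ` set fs"
  by (metis set_map set_rev)

lemma forced_color_eq_wsum:
  assumes "map fst fs = rev es" "distinct es"
  shows "forced_color fs v = wsum (\<lambda>e. (e, True) \<in> set fs) (set es) v"
proof -
  let ?f = "filter (\<lambda>q. snd q \<and> inc v (fst q)) fs"
  have "distinct (map fst fs)" unfolding assms(1) using assms(2) by simp
  then have "distinct (map fst ?f)" by (rule distinct_map_filter)
  from distinct_card[OF this] have "length ?f = card (set (map fst ?f))" by simp
  moreover have "set (map fst ?f) = {e \<in> set es. inc v e \<and> (e, True) \<in> set fs}"
  proof -
    have es: "e \<in> set es" if "(e, True) \<in> set fs" for e
      using imageI[OF that, of fst] unfolding set_keys[OF assms(1)] by simp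
    show ?thesis
    proof (rule equalityI; rule subsetI)
      fix e assume "e \<in> set (map fst ?f)"
      then obtain q where q: "q \<in> set fs" "snd q" "inc v (fst q)" "e = fst q" by auto
      then have "(e, True) = q" by (simp add: prod_eq_iff)
      then have "(e, True) \<in> set fs" using q(1) by simp
      with q es show "e \<in> {e \<in> set es. inc v e \<and> (e, True) \<in> set fs}" by simp
    next
      fix e assume "e \<in> {e \<in> set es. inc v e \<and> (e, True) \<in> set fs}"
      then have "(e, True) \<in> set ?f" by simp
      from imageI[OF this, of fst] show "e \<in> set (map fst ?f)" by simp
    qed
  qed
  ultimately show ?thesis by (simp add: forced_color_def wsum_def)
qed

lemma solvable_Cons:
  assumes "solvable fs D" "e \<notin> fst ` set fs"
  shows "solvable ((e, True) # fs) D \<or> solvable ((e, False) # fs) D"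
proof -
  obtain w where w: "\<And>e'. e' \<in> D \<Longrightarrow> allowed fs e' (w e')"
      "\<And>e'. e' \<in> D \<Longrightarrow> wsum w D (fst e') \<noteq> wsum w D (snd e')"
    using assms(1) unfolding solvable_def by blast
  have "allowed ((e, w e) # fs) e' (w e')" if "e' \<in> D" for e'
    using w(1)[OF that] by (auto simp: allowed_def)
  then have "solvable ((e, w e) # fs) D" unfolding solvable_def using w(2) by blast
  then show ?thesis by (cases "w e") auto
qed

text \<open>With an exact test, solvability is an invariant: if forcing weight 1 fails, no solution
  has that weight, so forcing weight 0 is safe.\<close>

lemma solvable_greedy:
  assumes "distinct es" "\<And>fs. consistent fs es U \<longleftrightarrow> solvable fs (set es)" "solvable [] (set es)"
  shows "solvable (greedy es U) (set es)"
proof -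
  let ?step = "\<lambda>fs e. (e, consistent ((e, True) # fs) es U) # fs"
  have "solvable (foldl ?step a xs) (set es)"
    if "solvable a (set es)" "distinct xs" "fst ` set a \<inter> set xs = {}" for a xs
    using that
  proof (induction xs arbitrary: a)
    case (Cons x xs)
    have "solvable (?step a x) (set es)"
      using solvable_Cons[of a "set es" x] Cons.prems assms(2)[of "(x, True) # a"] by (cases "consistent ((x, True) # a) es U") auto
    then show ?case using Cons.IH[of "?step a x"] Cons.prems by auto
  qed simp
  then show ?thesis using assms by (simp add: greedy_def)
qed

lemma forced_color_solution:
  assumes "solvable fs (set es)" "map fst fs = rev es" "distinct es" "e \<in> set es"
  shows "forced_color fs (fst e) \<noteq> forced_color fs (snd e)"
proof -
  obtain w where w: "\<And>e. e \<in> set es \<Longrightarrow> allowed fs e (w e)"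
      "\<And>e. e \<in> set es \<Longrightarrow> wsum w (set es) (fst e) \<noteq> wsum w (set es) (snd e)"
    using assms(1) unfolding solvable_def by blast
  have img: "set es = fst ` set fs" using assms(2) by (rule set_keys)
  have fs_w: "(e, True) \<in> set fs \<longleftrightarrow> w e" if "e \<in> set es" for e
  proof
    assume "(e, True) \<in> set fs"
    from w(1)[OF that, unfolded allowed_def, THEN bspec, OF this] show "w e" by simp
  next
    assume "w e"
    from that img obtain q where q: "q \<in> set fs" "fst q = e" by auto
    then have "snd q" using w(1)[OF that] \<open>w e\<close> by (simp add: allowed_def)
    with q(2) have "(e, True) = q" by (simp add: prod_eq_iff)
    then show "(e, True) \<in> set fs" using q(1) by simp
  qed
  have "wsum (\<lambda>e. (e, True) \<in> set fs) (set es) v = wsum w (set es) v" for v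
    by (intro wsum_cong fs_w)
  then show ?thesis using w(2)[OF assms(4)] by (simp add: forced_color_eq_wsum[OF assms(2,3)])
qed

lemma extend_tuples: "set U = tuples N K \<Longrightarrow> set (extend N U) = tuples N (Suc K)"
proof -
  have "tuples N (Suc K) = (\<Union>X\<in>tuples N K. (\<lambda>v. v # X) ` {..<N})"
    by (auto simp: tuples_def length_Suc_conv image_iff)
  then show "set U = tuples N K \<Longrightarrow> set (extend N U) = tuples N (Suc K)"
    by (simp add: extend_def atLeast_upt)
qed

definition universe :: "bool list list \<Rightarrow> nat \<Rightarrow> nat list list" where
  "universe A K = (extend (base A) ^^ K) [[]]"

lemma set_universe: "set (universe A K) = tuples (base A) K"
proof (induction K)
  case 0
  show ?case by (auto simp: universe_def tuples_def)
next
  case (Suc K)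
  then show ?case using extend_tuples by (simp add: universe_def)
qed

text \<open>No relation between \<open>K\<close> and the treewidth is assumed: a failed test refutes
  solvability by soundness, and \<open>attempt\<close> has compared the forced colors itself before
  answering yes.\<close>

lemma correct_attempt:
  assumes graph: "simple_graph {..<n} E" and att: "attempt (adj n E) (universe (adj n E) K) = Some r"
  shows "correct_answer n E (enc r)"
proof -
  let ?A = "adj n E" and ?U = "universe (adj n E) K"
  let ?es = "edges ?A"
  have len: "length ?es < base ?A" by (simp add: base_def)
  note dist = distinct_edges_adj[of n E]
  show ?thesis
  proof (cases "consistent [] ?es ?U")
    case False
    then have "r = None" using att by (simp add: attempt_def)
    moreover have "\<not> solvable [] (set ?es)"
      using False consistent_sound[OF dist set_universe len] by blast
    then have "\<nexists>w. proper_weight E w" using proper_weight_imp_solvable[OF graph] by blast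
    ultimately show ?thesis by (simp add: correct_answer_def)
  next
    case True
    define fs where "fs = greedy ?es ?U"
    have r: "r = Some (matrix fs n)" and val: "\<And>e. e \<in> set ?es \<Longrightarrow> forced_color fs (fst e) \<noteq> forced_color fs (snd e)"
      using att True unfolding attempt_def fs_def by (auto split: if_splits)
    have fst_fs: "map fst fs = rev ?es" unfolding fs_def by (rule greedy_fst)
    let ?w = "weight_of (\<lambda>e. (e, True) \<in> set fs)"
    have proper: "proper_weight E ?w"
      by (rule proper_weight_weight_of[OF graph]) (use val in \<open>simp add: forced_color_eq_wsum[OF fst_fs dist]\<close>)
    have img: "set ?es = fst ` set fs" using fst_fs by (rule set_keys)
    have "(\<exists>q\<in>set fs. snd q \<and> (fst q = (i, j) \<or> fst q = (j, i))) \<longleftrightarrow> {i, j} \<in> E \<and> ?w {i, j} = 1" (is "?L \<longleftrightarrow> ?R") for i j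
    proof
      assume ?L
      then obtain a b where ab: "((a, b), True) \<in> set fs" "(a, b) = (i, j) \<or> (a, b) = (j, i)"
        by (metis (full_types) prod.collapse)
      then have "(a, b) \<in> set ?es" unfolding img by force
      then have "{a, b} \<in> E" "a < b" by (auto simp: set_edges_adj)
      moreover have "{i, j} = {a, b}" using ab(2) by auto
      ultimately show ?R using ab(1) by (simp add: weight_of_def)
    next
      assume R: ?R
      then obtain a b where ab: "{i, j} = {a, b}" "a < b" using edge_cases[OF graph] by metis
      then have "((a, b), True) \<in> set fs" using R by (simp add: weight_of_def split: if_splits)
      moreover have "(a, b) = (i, j) \<or> (a, b) = (j, i)" using ab by (auto simp: doubleton_eq_iff)
      ultimately show ?L by force
    qed
    then have "enc r = encode_weights n E ?w"
      unfolding r matrix_def encode_weights_def encode_matrix_def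
      by (simp add: enc_list_def enc_bool_def comp_def)
    then show ?thesis using proper unfolding correct_answer_def by auto
  qed
qed

text \<open>The decomposition with the single bag \<open>V\<close> shows that the minimum is taken
  over a nonempty set.\<close>

lemma treewidth_witness:
  assumes "simple_graph V E"
  obtains I :: "nat set" and F B where "tree_decomposition V E I F B" "width I B = treewidth V E"
proof -
  have "\<not> is_cycle {} c" for c :: "nat list" by (cases c) (auto simp: is_cycle_def)
  then have "is_tree {0 :: nat} {}"
    by (simp add: is_tree_def simple_graph_def connected_graph_def)
  then have "tree_decomposition V E {0 :: nat} {} (\<lambda>_. V)"
    using assms by (auto simp: tree_decomposition_def simple_graph_def connected_graph_def)
  then have "\<exists>k. \<exists>(I :: nat set) F B. tree_decomposition V E I F B \<and> width I B = k" by blast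
  then have "\<exists>(I :: nat set) F B. tree_decomposition V E I F B \<and> width I B = treewidth V E"
    unfolding treewidth_def by (rule LeastI_ex)
  then show thesis using that by blast
qed

lemma attempt_succeeds:
  assumes graph: "simple_graph {..<n} E"
  shows "attempt (adj n E) (universe (adj n E) (Suc (treewidth {..<n} E))) \<noteq> None"
proof -
  let ?A = "adj n E" and ?K = "Suc (treewidth {..<n} E)"
  let ?U = "universe ?A ?K" and ?es = "edges ?A"
  have len: "length ?es < base ?A" and n: "n < base ?A" by (simp_all add: base_def)
  note dist = distinct_edges_adj[of n E]
  obtain I :: "nat set" and F B where td: "tree_decomposition {..<n} E I F B"
      and width: "width I B = treewidth {..<n} E"
    using treewidth_witness[OF graph] .
  have B: "B t \<subseteq> {..<n}" "card (B t) \<le> ?K" if "t \<in> I" for t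
  proof -
    show "B t \<subseteq> {..<n}" using td that by (auto simp: tree_decomposition_def)
    have "finite I" using td by (simp add: tree_decomposition_def is_tree_def simple_graph_def)
    then have "card (B t) \<le> Max ((\<lambda>t. card (B t)) ` I)" using that by simp
    \<comment> \<open>\<open>width\<close> is the largest bag size minus 1, truncated at 0; in
      either case a bag has at most \<open>Suc\<close> of the width many elements.\<close>
    then show "card (B t) \<le> ?K" using width by (simp add: width_def)
  qed
  have cons: "consistent fs ?es ?U \<longleftrightarrow> solvable fs (set ?es)" for fs
  proof
    assume "consistent fs ?es ?U"
    then show "solvable fs (set ?es)"
    proof (rule consistent_complete[OF dist set_universe td, rotated 2])
      show "{fst e, snd e} \<in> E \<and> {fst e, snd e} \<subseteq> {..<n}" if "e \<in> set ?es" for e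
        using that by (auto simp: set_edges_adj)
      fix t assume t: "t \<in> I"
      have fin: "finite (B t)" using B(1)[OF t] finite_subset by blast
      \<comment> \<open>\<open>n\<close> is not a vertex and pads the bag to the required length.\<close>
      let ?X = "sorted_list_of_set (B t) @ replicate (?K - card (B t)) n"
      have "?X \<in> tuples (base ?A) ?K"
        using B[OF t] fin n by (auto simp: tuples_def)
      moreover have "\<forall>v\<in>{..<n}. v \<in> set ?X \<longleftrightarrow> v \<in> B t" using fin by auto
      ultimately show "\<exists>X\<in>set ?U. \<forall>v\<in>{..<n}. v \<in> set X \<longleftrightarrow> v \<in> B t"
        unfolding set_universe by blast
    qed
  qed (rule consistent_sound[OF dist set_universe len])
  show ?thesis
  proof (cases "consistent [] ?es ?U")
    case True
    then have "solvable (greedy ?es ?U) (set ?es)"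
      using solvable_greedy[OF dist cons] cons by blast
    then have "\<forall>e\<in>set ?es. forced_color (greedy ?es ?U) (fst e) \<noteq> forced_color (greedy ?es ?U) (snd e)"
      using forced_color_solution[OF _ greedy_fst dist] by blast
    then show ?thesis by (simp add: attempt_def)
  qed (simp add: attempt_def)
qed

section \<open>The search loop\<close>

text \<open>\<open>While\<close> continues on values other than \<open>Null\<close>, whereas the
  search continues while the result is \<open>None\<close>, encoded as \<open>Null\<close>; hence
  the inversion.\<close>

definition search_test :: prog where
  "search_test = Cond Second Const_Null (Make_Pair Const_Null Const_Null)"

lemma exec_search:
  fixes f :: "'a::enc \<times> 'b::enc option \<Rightarrow> 'a \<times> 'b option"
  assumes q: "\<And>z. exec q (enc z) (enc (f z)) (\<tau> z)"
    and "\<And>k. k < m \<Longrightarrow> snd ((f ^^ k) z) = None" "snd ((f ^^ m) z) = Some r"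
    and "\<And>k. k < m \<Longrightarrow> \<tau> ((f ^^ k) z) \<le> M"
  shows "\<exists>t. exec (While search_test q) (enc z) (enc ((f ^^ m) z)) t \<and> t \<le> m * (M + 6) + 4"
  using assms(2-)
proof (induction m arbitrary: z)
  case 0
  obtain a where z: "z = (a, Some r)" using 0 by (cases z) auto
  have "exec search_test (enc z) Null (1 + 1 + 1)"
    unfolding search_test_def z enc_simps
    by (rule exec.Cond_True[OF exec.Second_Pair _ exec.Const_Null]) simp
  then have "exec (While search_test q) (enc z) (enc z) (1 + 1 + 1 + 1)" by (rule exec.While_False)
  then show ?case by (auto simp: eval_nat_numeral)
next
  case (Suc m)
  obtain a where z: "z = (a, None)" using Suc.prems(1)[of 0] by (cases z) auto
  have test: "exec search_test (enc z) (Pair Null Null) (1 + (1 + 1 + 1) + 1)"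
    unfolding search_test_def z enc_simps
    by (rule exec.Cond_False[OF exec.Second_Pair exec.Make_Pair[OF exec.Const_Null exec.Const_Null]])
  have "\<And>k. k < m \<Longrightarrow> snd ((f ^^ k) (f z)) = None" "snd ((f ^^ m) (f z)) = Some r"
    "\<And>k. k < m \<Longrightarrow> \<tau> ((f ^^ k) (f z)) \<le> M"
    using Suc.prems(1,3)[of "Suc _"] Suc.prems(2) by (simp_all add: funpow_swap1)
  then obtain t where t: "exec (While search_test q) (enc (f z)) (enc ((f ^^ m) (f z))) t" "t \<le> m * (M + 6) + 4"
    using Suc.IH by blast
  have "exec (While search_test q) (enc z) (enc ((f ^^ Suc m) z)) (1 + (1 + 1 + 1) + 1 + \<tau> z + t + 1)"
    using exec.While_True[OF test _ q t(1)] by (simp add: funpow_swap1)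
  moreover have "\<tau> z \<le> M" using Suc.prems(3)[of 0] by simp
  then have "1 + (1 + 1 + 1) + 1 + \<tau> z + t + 1 \<le> Suc m * (M + 6) + 4" using t(2) by simp
  ultimately show ?case by blast
qed

definition start :: "bool list list \<Rightarrow> state" where
  "start A = ((A, [[]]), None)"

lemma next_state_iter:
  "(next_state ^^ k) (start A) =
     ((A, universe A k), if k = 0 then None else attempt A (universe A k))"
  by (induction k) (auto simp: start_def universe_def next_state_def)

lemma sum_pow_le:
  fixes s :: nat assumes "2 \<le> s"
  shows "s ^ a + s ^ b \<le> s ^ (a + b + 1)"
proof -
  have "s ^ a + s ^ b \<le> s ^ (a + b) + s ^ (a + b)"
    using assms by (intro add_mono power_increasing) auto
  also have "\<dots> = 2 * s ^ (a + b)" by simp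
  also have "\<dots> \<le> s ^ (a + b + 1)" using assms by simp
  finally show ?thesis .
qed

lemma le_pow: "2 \<le> (s :: nat) \<Longrightarrow> k \<le> s ^ k"
  by (metis less_exp less_imp_le order_trans power_mono zero_le)

lemma solver:
  obtains p a c where
    "\<And>(n :: nat) E. simple_graph {..<n} E \<Longrightarrow> \<exists>y t. exec p (encode_graph n E) y t \<and> correct_answer n E y \<and>
       t \<le> sz (start (adj n E)) ^ (a + treewidth {..<n} E + c * c ^ treewidth {..<n} E)"
proof -
  have "polytime (\<lambda>A :: bool list list. ((A, [[]] :: nat list list), None :: bool list list option option))"
    by (intro polytime_rules)
  then have "polytime start" unfolding start_def .
  then obtain q0 \<tau>0 where q0: "\<And>A. exec q0 (enc A) (enc (start A)) (\<tau>0 A)" and "polybd \<tau>0"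
    unfolding polytime_def by blast
  then obtain c0 where c0: "\<And>A. \<tau>0 A \<le> sz A ^ c0" unfolding polybd_def by blast
  obtain q \<tau> where q: "\<And>z. exec q (enc z) (enc (next_state z)) (\<tau> z)" and "polybd \<tau>" "polybd (\<lambda>z. sz (next_state z))"
    using polytime_next_state unfolding polytime_def by blast
  then obtain c1 c2 where c12: "\<And>z. \<tau> z \<le> sz z ^ c1" "\<And>z. sz (next_state z) \<le> sz z ^ c2"
    unfolding polybd_def by blast
  define c where "c = c1 + c2 + 1"
  have c: "\<tau> z \<le> sz z ^ c" "sz (next_state z) \<le> sz z ^ c" for z
    using c12[of z] pow_mono_sz[of c1 c z] pow_mono_sz[of c2 c z] by (auto simp: c_def)
  let ?p = "Seq q0 (Seq (While search_test q) (Seq Second Second))"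
  \<comment> \<open>The estimates below use 19 of these 60.\<close>
  define a where "a = c0 + 60"
  show thesis
  proof (rule that[of ?p a c])
    fix n :: nat and E assume graph: "simple_graph {..<n} E"
    define A where "A = adj n E"
    define k where "k = treewidth {..<n} E"
    define s where "s = sz (start A)"
    have s2: "2 \<le> s" unfolding s_def by (rule sz_ge)
    have s_pow: "s ^ i \<le> s ^ j" if "i \<le> j" for i j
      unfolding s_def using that by (rule pow_mono_sz)
    \<comment> \<open>A round raises the size at most to the power \<open>c\<close>, and exponents
      multiply under iteration.\<close>
    have size: "sz ((next_state ^^ i) (start A)) \<le> s ^ (c ^ i)" for i
    proof (induction i)
      case (Suc i)
      have "sz ((next_state ^^ Suc i) (start A)) \<le> sz ((next_state ^^ i) (start A)) ^ c"
        using c(2) by simp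
      also have "\<dots> \<le> (s ^ (c ^ i)) ^ c" using Suc by (rule power_mono) simp
      finally show ?case by (simp add: power_mult [symmetric] mult.commute)
    qed (simp add: s_def)
    let ?Q = "\<lambda>m. 0 < m \<and> attempt A (universe A m) \<noteq> None"
    have ex: "?Q (Suc k)" using attempt_succeeds[OF graph] by (simp add: A_def k_def)
    \<comment> \<open>The program stops at the first round that decides, which is round
      \<open>Suc k\<close> at the latest.\<close>
    define m where "m = (LEAST m. ?Q m)"
    have m: "?Q m" unfolding m_def using ex by (rule LeastI)
    have mk: "m \<le> Suc k" unfolding m_def using ex by (rule Least_le)
    have before: "\<not> ?Q i" if "i < m" for i using that unfolding m_def by (rule not_less_Least)
    obtain r where r: "attempt A (universe A m) = Some r" using m by blast
    let ?M = "s ^ (c ^ m)"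
    have "snd ((next_state ^^ i) (start A)) = None" if "i < m" for i
      using before[OF that] by (auto simp: next_state_iter)
    moreover have fin: "(next_state ^^ m) (start A) = ((A, universe A m), Some r)"
      using m r by (simp add: next_state_iter)
    moreover have "\<tau> ((next_state ^^ i) (start A)) \<le> ?M" if "i < m" for i
    proof -
      have "\<tau> ((next_state ^^ i) (start A)) \<le> (s ^ (c ^ i)) ^ c"
        using c(1) size by (meson order_trans power_mono zero_le)
      also have "\<dots> = s ^ (c ^ Suc i)" by (simp add: power_mult [symmetric] mult.commute)
      also have "\<dots> \<le> ?M" using that by (intro s_pow power_increasing) (auto simp: c_def)
      finally show ?thesis .
    qed
    ultimately obtain t where t: "exec (While search_test q) (enc (start A)) (enc ((A, universe A m), Some r)) t"
        "t \<le> m * (?M + 6) + 4"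
      using exec_search[of q next_state \<tau> m "start A" r ?M] q by auto
    have out: "exec (Seq Second Second) (enc ((A, universe A m), Some r)) (enc r) (1 + 1 + 1)"
      unfolding enc_simps by (rule exec.Seq[OF exec.Second_Pair exec.Second_Pair])
    have run: "exec ?p (enc A) (enc r) (\<tau>0 A + (t + (1 + 1 + 1) + 1) + 1)"
      by (rule exec.Seq[OF q0 exec.Seq[OF t(1) out]])
    have "\<tau>0 A + (t + (1 + 1 + 1) + 1) + 1 \<le> s ^ (a + k + c * c ^ k)"
    proof -
      have "sz A \<le> s" by (simp add: s_def start_def)
      then have 0: "\<tau>0 A \<le> s ^ c0" using c0 by (meson order_trans power_mono zero_le)
      have "c ^ m \<le> c ^ Suc k" using mk by (rule power_increasing) (simp add: c_def)
      then have M: "?M \<le> s ^ (c * c ^ k)" using s_pow by simp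
      have "?M + 6 \<le> s ^ (c * c ^ k) + s ^ 6" using M le_pow[OF s2, of 6] by (rule add_mono)
      also have "\<dots> \<le> s ^ (c * c ^ k + 7)" using sum_pow_le[OF s2, of "c * c ^ k" 6] by (simp add: add.commute)
      finally have 1: "?M + 6 \<le> s ^ (c * c ^ k + 7)" .
      have "m \<le> s ^ Suc k" using mk le_pow[OF s2, of "Suc k"] by linarith
      from mult_le_mono[OF this 1] have 2: "m * (?M + 6) \<le> s ^ (Suc k + (c * c ^ k + 7))"
        by (simp only: power_add)
      \<comment> \<open>9 collects the constants: 4 from the loop, 3 from the projection and 2 from
        the two outer \<open>Seq\<close>.\<close>
      have 3: "9 \<le> s ^ 9" by (rule le_pow[OF s2])
      have "\<tau>0 A + (t + (1 + 1 + 1) + 1) + 1 \<le> s ^ c0 + (s ^ (Suc k + (c * c ^ k + 7)) + s ^ 9)"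
        using 0 2 3 t(2) by linarith
      also have "\<dots> \<le> s ^ c0 + s ^ (Suc k + (c * c ^ k + 7) + 9 + 1)"
        using sum_pow_le[OF s2] by (rule add_left_mono)
      also have "\<dots> \<le> s ^ (c0 + (Suc k + (c * c ^ k + 7) + 9 + 1) + 1)"
        by (rule sum_pow_le[OF s2])
      also have "\<dots> \<le> s ^ (a + k + c * c ^ k)" by (rule s_pow) (simp add: a_def)
      finally show ?thesis .
    qed
    moreover have "correct_answer n E (enc r)"
      using correct_attempt[OF graph] r by (simp add: A_def)
    ultimately show "\<exists>y t. exec ?p (encode_graph n E) y t \<and> correct_answer n E y \<and>
       t \<le> sz (start (adj n E)) ^ (a + treewidth {..<n} E + c * c ^ treewidth {..<n} E)"
      using run unfolding enc_adj [symmetric] A_def [symmetric] s_def k_def by blast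
  qed
qed

section \<open>The time bound\<close>

lemma sz_list_le: "(\<And>x. x \<in> set xs \<Longrightarrow> sz x \<le> d) \<Longrightarrow> sz xs \<le> length xs * (d + 1) + 2"
  by (induction xs) (auto, fastforce)

text \<open>As \<open>n\<close> is at least 2, the constant 32 is at most \<open>n ^ 5\<close>,
  which together with the quadratic size of the matrix gives 7. This is the factor 7 of the final
  exponent.\<close>

lemma sz_start_adj:
  assumes "2 \<le> n" shows "sz (start (adj n E)) \<le> n ^ 7"
proof -
  have "sz (map (\<lambda>j. {i, j} \<in> E) [0..<n]) \<le> n * 6 + 2" for i
    using sz_list_le[of "map (\<lambda>j. {i, j} \<in> E) [0..<n]" 5] by (auto simp: sz_bool_le)
  then have "sz (adj n E) \<le> n * (n * 6 + 3) + 2"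
    unfolding adj_def
    using sz_list_le[of "map (\<lambda>i. map (\<lambda>j. {i, j} \<in> E) [0..<n]) [0..<n]" "n * 6 + 2"] by (auto simp: algebra_simps)
  then have "sz (start (adj n E)) \<le> n * (n * 6 + 3) + 12" by (simp add: start_def)
  also have "\<dots> \<le> n ^ 7"
  proof -
    obtain k where n: "n = k + 2" using assms by (metis add.commute le_Suc_ex)
    have "(32 :: nat) \<le> n ^ 5" using power_mono[OF assms, of 5] by simp
    then have "32 * n ^ 2 \<le> n ^ 5 * n ^ 2" by (rule mult_le_mono1)
    moreover have "n ^ 5 * n ^ 2 = n ^ 7" by (simp flip: power_add)
    moreover have "n * (n * 6 + 3) + 12 \<le> 32 * n ^ 2" unfolding n by (simp add: power2_eq_square algebra_simps)
    ultimately show ?thesis by simp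
  qed
  finally show ?thesis .
qed

lemma polytime_times_const: "polytime f \<Longrightarrow> polytime (\<lambda>x. c * f x :: nat)"
  by (induction c) (auto intro: polytime_rules)

text \<open>In unary, powers are exponentially large, so \<open>polytime_foldl\<close> does not
  apply. Computability asks for termination only; the loop lemma is used directly, with the sum of
  all step times as a crude bound.\<close>

lemma exec_power: "\<exists>p. \<forall>k. \<exists>t. exec p (enc k) (enc ((c :: nat) ^ k)) t"
proof -
  have "polytime (\<lambda>p :: unit \<times> nat \<times> unit. c * fst (snd p))" by (intro polytime_times_const polytime_rules)
  then obtain q \<tau> where q: "\<And>p :: unit \<times> nat \<times> unit. exec q (enc p) (enc (c * fst (snd p))) (\<tau> p)"
    unfolding polytime_def by blast
  have "polytime (\<lambda>k :: nat. ((), replicate k (), 1 :: nat))" by (intro polytime_rules polytime_units)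
  then obtain q0 \<tau>0 where q0: "\<And>k :: nat. exec q0 (enc k) (enc ((), replicate k (), 1 :: nat)) (\<tau>0 k)"
    unfolding polytime_def by blast
  let ?W = "While (Seq Second First) (foldl_body q)"
  have fold: "foldl (\<lambda>a _. c * a) x (replicate k ()) = c ^ k * x" for k x
    by (induction k arbitrary: x) (auto simp: mult.assoc mult.commute)
  have "\<exists>t. exec (Seq q0 (Seq ?W (Seq Second Second))) (enc k) (enc (c ^ k)) t" for k
  proof -
    let ?M = "\<Sum>i\<le>k. \<tau> ((), c ^ i, ())"
    have "\<tau> ((), foldl (\<lambda>a _. c * a) 1 ys1, y) \<le> ?M" if "replicate k () = ys1 @ y # ys2" for ys1 y ys2
    proof -
      have "ys1 = replicate (length ys1) ()" by (simp add: replicate_length_same)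
      then have "foldl (\<lambda>a _. c * a) 1 ys1 = c ^ length ys1" by (metis fold mult.right_neutral)
      moreover have "length ys1 \<le> k" using arg_cong[OF that, of length] by simp
      ultimately show ?thesis by (auto intro!: member_le_sum)
    qed
    then obtain t where "exec ?W (enc ((), replicate k (), 1 :: nat)) (enc ((), [] :: unit list, foldl (\<lambda>a _. c * a) 1 (replicate k ()))) t"
      using exec_foldl_loop[of q "()" "\<lambda>a _. c * a" \<tau> "replicate k ()" 1 ?M] q[of "((), _, _)"] by auto
    then have "exec ?W (enc ((), replicate k (), 1 :: nat)) (enc ((), [] :: unit list, c ^ k)) t"
      by (simp add: fold)
    moreover have "exec (Seq Second Second) (enc ((), [] :: unit list, c ^ k)) (enc (c ^ k)) (1 + 1 + 1)"
      unfolding enc_simps by (rule exec.Seq[OF exec.Second_Pair exec.Second_Pair])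
    ultimately show ?thesis using q0 exec.Seq by meson
  qed
  then show ?thesis by blast
qed

lemma computable_exponent: "computable (\<lambda>k. 7 * (a + k + c * c ^ k))"
proof -
  have "polytime (\<lambda>p :: nat \<times> nat. 7 * (a + fst p + c * snd p))" by (intro polytime_times_const polytime_rules)
  then obtain q \<tau> where q: "\<And>p :: nat \<times> nat. exec q (enc p) (enc (7 * (a + fst p + c * snd p))) (\<tau> p)"
    unfolding polytime_def by blast
  obtain p where p: "\<And>k. \<exists>t. exec p (enc k) (enc (c ^ k)) t" using exec_power by metis
  have "\<exists>t. exec (Seq (Make_Pair Self p) q) (enc k) (enc (7 * (a + k + c * c ^ k))) t" for k
  proof -
    obtain t where "exec p (enc k) (enc (c ^ k)) t" using p by blast
    then have "exec (Make_Pair Self p) (enc k) (enc (k, c ^ k)) (1 + t + 1)"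
      unfolding enc_simps by (rule exec.Make_Pair[OF exec.Self])
    from exec.Seq[OF this q] show ?thesis by auto
  qed
  then show ?thesis unfolding computable_def enc_nat_def by blast
qed

lemma computable_const: "computable (\<lambda>_. k)"
  using exec_const[of "encode_nat k"] unfolding computable_def by blast

text \<open>Fewer than two vertices form a special case of the time bound: \<open>max 1 n\<close> is
  1 there, and its powers leave no room for the running time.\<close>

lemma small_graph:
  assumes "simple_graph {..<n :: nat} E" "n < 2" shows "E = {}"
proof (rule equals0I)
  fix e assume "e \<in> E"
  then have "e \<subseteq> {..<n}" "card e = 2" using assms(1) by (simp_all add: simple_graph_def)
  then have "2 \<le> n" using card_mono[of "{..<n}" e] by simp
  then show False using assms(2) by simp
qed

theorem theorem2:
  "\<exists>p. runs_in_XP_time p \<and> decides_proper_weight p"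
proof -
  obtain p a c where p: "\<And>(n :: nat) E. simple_graph {..<n} E \<Longrightarrow> \<exists>y t. exec p (encode_graph n E) y t \<and>
      correct_answer n E y \<and>
      t \<le> sz (start (adj n E)) ^ (a + treewidth {..<n} E + c * c ^ treewidth {..<n} E)"
    using solver by blast
  have "decides_proper_weight p" unfolding decides_proper_weight_def using p by blast
  moreover have "runs_in_XP_time p"
  proof -
    have empty: "\<exists>y t. exec p (encode_graph n {}) y t" for n
      using p[of n "{}"] by (auto simp: simple_graph_def)
    obtain y0 t0 y1 t1 where small: "exec p (encode_graph 0 {}) y0 t0" "exec p (encode_graph 1 {}) y1 t1"
      using empty by metis
    \<comment> \<open>\<open>t0\<close> and \<open>t1\<close> pay for the two graphs with fewer than
      two vertices; the summand 1 keeps the factor positive for the others.\<close>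
    let ?f = "\<lambda>_ :: nat. t0 + t1 + 1" and ?g = "\<lambda>k. 7 * (a + k + c * c ^ k)"
    have "\<exists>y t. exec p (encode_graph n E) y t \<and>
        t \<le> ?f (treewidth {..<n} E) * max 1 n ^ ?g (treewidth {..<n} E)"
      if graph: "simple_graph {..<n} E" for n E
    proof (cases "2 \<le> n")
      case True
      let ?h = "a + treewidth {..<n} E + c * c ^ treewidth {..<n} E"
      obtain y t where y: "exec p (encode_graph n E) y t" "t \<le> sz (start (adj n E)) ^ ?h"
        using p[OF graph] by blast
      note y(2)
      also have "sz (start (adj n E)) ^ ?h \<le> (n ^ 7) ^ ?h"
        by (rule power_mono[OF sz_start_adj[OF True]]) simp
      also have "\<dots> = max 1 n ^ ?g (treewidth {..<n} E)"
      proof -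
        have "max 1 n = n" using True by simp
        then show ?thesis by (simp only: power_mult)
      qed
      also have "\<dots> \<le> (t0 + t1 + 1) * max 1 n ^ ?g (treewidth {..<n} E)" by simp
      finally show ?thesis using y(1) by blast
    next
      case False
      then have E: "E = {}" using small_graph[OF graph] by simp
      from False consider "n = 0" | "n = 1" by linarith
      then show ?thesis
      proof cases
        case 1
        then show ?thesis using small(1) E by (intro exI[of _ y0] exI[of _ t0]) simp
      next
        case 2
        then show ?thesis using small(2) E by (intro exI[of _ y1] exI[of _ t1]) simp
      qed
    qed
    then show ?thesis unfolding runs_in_XP_time_def
      using computable_const computable_exponent by blast
  qed
  ultimately show ?thesis by blast
qed

end
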